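(* Let $\mathfrak{A}=\{A_1,\dots,A_m\}$ be a finite collection of mutually exterior annuli in $\mathcal{A}$. Let $t\in\mathfrak{A}_0$ and let $\tau:\hat{\mathbb{C}}\to\hat{\mathbb{C}}$ be the translation $z\mapsto z-t$ (with $\tau(\infty)=\infty$). Then there exists $N\in\mathbb{N}$ such that for every integer $n\ge N$ (with $\infty$ an attracting fixed point of $\tau^{-1}\circ R_{\tau(\mathfrak{A}),n}\circ\tau$, so that the sets below are defined): (i) $\mathfrak{A}_0\subset\mathcal{K}(\tau^{-1}\circ R_{\tau(\mathfrak{A}),n}\circ\tau)$; (ii) $\mathfrak{A}_\infty\subset\mathcal{L}(\tau^{-1}\circ R_{\tau(\mathfrak{A}),n}\circ\tau)$; (iii) $\mathcal{J}(\tau^{-1}\circ R_{\tau(\mathfrak{A}),n}\circ\tau)\subset\mathfrak{A}_+$; (iv) for every $A_i\in\mathfrak{A}$, any path connecting a point of $A_{i,\infty}$ to a point of $A_{i,0}$ has nonempty intersection with $\mathcal{J}(\tau^{-1}\circ R_{\tau(\mathfrak{A}),n}\circ\tau)$.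
   Context: $\hat{\mathbb{C}}=\mathbb{C}\cup\{\infty\}$ is the Riemann sphere. For a rational map $f$ of $\hat{\mathbb{C}}$ for which $\infty$ is an attracting fixed point: $\mathcal{L}(f)$ is the basin of attraction of $\infty$ for $f$ (the set of points whose forward iterates converge to $\infty$), $\mathcal{K}(f)=\hat{\mathbb{C}}\setminus\mathcal{L}(f)$, and $\mathcal{J}(f)=\partial\mathcal{K}(f)$. $\mathcal{A}$ is the collection of all subsets $A\subset\hat{\mathbb{C}}$ that are the closure of an open annulus which is bounded (i.e. disjoint from some ball about $\infty$). Standing assumptions on $A\in\mathcal{A}$: $\hat{\mathbb{C}}\setminus A$ consists of two topological disks, denoted $A_\infty$ (unbounded, containing $\infty$) and $A_0$ (bounded), so $\hat{\mathbb{C}}=A_\infty\sqcup A\sqcup A_0$; and the interior of $A$ contains a Jordan curve whose fundamental group injects into $\pi_1(A)$ under inclusion. For each $A\in\mathcal{A}$ the following choices are fixed once and for all. $\gamma_A$ is a Jordan curve contained in the interior of $A$ such that $\pi_1(\gamma_A)$ injects into $\pi_1(A)$ under inclusion. $U_A$ is the unbounded component of $\hat{\mathbb{C}}\setminus\gamma_A$. $\widetilde{\varphi_A}:\{z\in\hat{\mathbb{C}}: 1<|z|\}\to U_A$ is a conformal isomorphism with $\widetilde{\varphi_A}(\infty)=\infty$. $\epsilon=\epsilon(A)>0$ is small enough that $C_A:=\widetilde{\varphi_A}(\{|z|=1+\epsilon\})$ is contained in the interior of $A$. Define $\varphi_A:\{z\in\hat{\mathbb{C}}:\frac{1}{1+\epsilon}<|z|\}\to\hat{\mathbb{C}}$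 by $\varphi_A(z)=\widetilde{\varphi_A}((1+\epsilon)z)$. Its Laurent expansion is $\varphi_A(z)=c_Az+c_{(A,0)}+\frac{c_{(A,1)}}{z}+\frac{c_{(A,2)}}{z^2}+\cdots$ for $|z|\ge 1$; $c_A$ denotes the leading coefficient. For $n\in\mathbb{N}$ and $1\le k\le n$ let $r_A^{(k,n)}=\varphi_A(e^{2\pi i k/n})$ and $\omega_{A,n}(z)=c_A^{-n}\prod_{k=1}^n(z-r_A^{(k,n)})$. For a finite collection $\mathfrak{A}=\{A_1,\dots,A_m\}\subset\mathcal{A}$, $A_{i,0}$ and $A_{i,\infty}$ are the bounded and unbounded components of $\hat{\mathbb{C}}\setminus A_i$, and $|\mathfrak{A}|=m$. The elements of $\mathfrak{A}$ are mutually exterior if $A_j\cap(A_i\sqcup A_{i,0})=\emptyset$ for all $i\ne j$. In that case define $\mathfrak{A}_+=\bigcup_j A_j$, $\mathfrak{A}_0=\bigcup_j A_{j,0}$, $\mathfrak{A}_\infty=\bigcap_j A_{j,\infty}$ (so $\hat{\mathbb{C}}=\mathfrak{A}_0\sqcup\mathfrak{A}_+\sqcup\mathfrak{A}_\infty$), and rational functions $$\Omega_{\mathfrak{A},n}(z)=\left(\sum_{j=1}^{|\mathfrak{A}|}(\omega_{A_j,n}(z)+1)^{-1}\right)^{-1},\qquad R_{\mathfrak{A},n}(z)=z\cdot\Omega_{\mathfrak{A},n}(z).$$ $\tau(\mathfrak{A})=\{\tau(A_1),\dots,\tau(A_m)\}$, and $R_{\tau(\mathfrak{A}),n}$ is obtained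 from this construction applied to $\tau(\mathfrak{A})$. *)

theory Defs
  imports
    "HOL-Complex_Analysis.Complex_Analysis"
    "HOL-Computational_Algebra.Computational_Algebra"
    "HOL-Computational_Algebra.Field_as_Ring"
begin

section \<open>The Riemann sphere\<close>

text \<open>The point at infinity is \<^term>\<open>None\<close>.\<close>

type_synonym csphere = "complex option"

abbreviation riemann_sphere :: "csphere topology" where
  "riemann_sphere \<equiv> Alexandroff_compactification euclidean"

text \<open>The map \<open>z \<mapsto> 1 / z\<close> of the sphere.\<close>

definition sphere_inverse :: "csphere \<Rightarrow> csphere" where
  "sphere_inverse p =
     (case p of None \<Rightarrow> Some 0 | Some z \<Rightarrow> if z = 0 then None else Some (inverse z))"

definition translation :: "complex \<Rightarrow> csphere \<Rightarrow> csphere" where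
  "translation t = map_option (\<lambda>z. z - t)"

text \<open>\<open>{z. r < \<bar>z\<bar>}\<close> as a subset of the sphere; these are the balls about infinity.\<close>

definition exterior_disc :: "real \<Rightarrow> csphere set" where
  "exterior_disc r = insert None (Some ` {z. r < norm z})"

text \<open>
  The coordinate centred at a point \<open>p\<close> is \<open>z\<close> if \<open>p\<close> is finite and \<open>1 / z\<close> if
  \<open>p\<close> is infinity; \<open>sphere_param p\<close> is its inverse. The value of \<open>sphere_chart p\<close> at the one
  point outside the coordinate domain is irrelevant, since below it is only
  used near \<open>p\<close>.
\<close>

definition sphere_chart :: "csphere \<Rightarrow> csphere \<Rightarrow> complex" where
  "sphere_chart p q = (if p = None then the (sphere_inverse q) else the q)"

definition sphere_param :: "csphere \<Rightarrow> complex \<Rightarrow> csphere" where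
  "sphere_param p w = (if p = None then sphere_inverse (Some w) else Some w)"

text \<open>Intended for sets \<open>S\<close> that are open in the sphere.\<close>

definition sphere_holomorphic_on :: "(csphere \<Rightarrow> csphere) \<Rightarrow> csphere set \<Rightarrow> bool" where
  "sphere_holomorphic_on f S \<longleftrightarrow>
     continuous_map (subtopology riemann_sphere S) riemann_sphere f \<and>
     (\<forall>p\<in>S. (\<lambda>w. sphere_chart (f p) (f (sphere_param p w))) analytic_on {sphere_chart p p})"

definition conformal_iso :: "(csphere \<Rightarrow> csphere) \<Rightarrow> csphere set \<Rightarrow> csphere set \<Rightarrow> bool" where
  "conformal_iso f S T \<longleftrightarrow>
     bij_betw f S T \<and> sphere_holomorphic_on f S \<and> sphere_holomorphic_on (inv_into S f) T"


section \<open>Rational maps and the basin of infinity\<close>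

text \<open>
  The components of \<^const>\<open>quot_of_fract\<close> are coprime and the second is nonzero, so a zero of
  the denominator is a pole.
\<close>

definition rational_map :: "complex poly fract \<Rightarrow> csphere \<Rightarrow> csphere" where
  "rational_map F z =
     (let (p, q) = quot_of_fract F in
      case z of
        Some w \<Rightarrow> if poly q w = 0 then None else Some (poly p w / poly q w)
      | None \<Rightarrow> if degree p > degree q then None
                else Some (coeff p (degree q) / lead_coeff q))"

text \<open>
  The multiplier of a fixed point at infinity is computed in the coordinate \<open>w = 1 / z\<close>,
  as the derivative of \<open>w \<mapsto> 1 / f (1 / w)\<close> at \<open>0\<close>.
\<close>

definition attracting_fixed_point_at_infinity :: "(csphere \<Rightarrow> csphere) \<Rightarrow> bool" where
  "attracting_fixed_point_at_infinity f \<longleftrightarrow>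
     f None = None \<and>
     (\<exists>d. ((\<lambda>w. the (sphere_inverse (f (sphere_inverse (Some w))))) has_field_derivative d) (at 0) \<and>
          norm d < 1)"

definition basin :: "(csphere \<Rightarrow> csphere) \<Rightarrow> csphere set" where
  "basin f = {z. limitin riemann_sphere (\<lambda>n. (f ^^ n) z) None sequentially}"

definition filled_julia :: "(csphere \<Rightarrow> csphere) \<Rightarrow> csphere set" where
  "filled_julia f = - basin f"

definition julia :: "(csphere \<Rightarrow> csphere) \<Rightarrow> csphere set" where
  "julia f = riemann_sphere frontier_of (filled_julia f)"


section \<open>Annuli\<close>

definition open_annulus :: "csphere set \<Rightarrow> bool" where
  "open_annulus U \<longleftrightarrow>
     openin riemann_sphere U \<and>
     subtopology riemann_sphere U homeomorphic_space top_of_set {z::complex. 1 < norm z \<and> norm z < 2}"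

definition topological_disc :: "csphere set \<Rightarrow> bool" where
  "topological_disc D \<longleftrightarrow>
     subtopology riemann_sphere D homeomorphic_space top_of_set (ball (0::complex) 1)"

definition jordan_curve :: "csphere set \<Rightarrow> bool" where
  "jordan_curve C \<longleftrightarrow>
     subtopology riemann_sphere C homeomorphic_space top_of_set (sphere (0::complex) 1)"

text \<open>Homotopy of paths relative to their endpoints, inside \<open>S\<close>.\<close>

definition sphere_homotopic_paths ::
    "csphere set \<Rightarrow> (real \<Rightarrow> csphere) \<Rightarrow> (real \<Rightarrow> csphere) \<Rightarrow> bool" where
  "sphere_homotopic_paths S p q \<longleftrightarrow>
     homotopic_with (\<lambda>r. r 0 = p 0 \<and> r 1 = p 1) (top_of_set {0..1}) (subtopology riemann_sphere S) p q"

text \<open>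
  Injectivity of the homomorphism of fundamental groups induced by the inclusion
  of \<open>S\<close> into \<open>T\<close>, at every base point of \<open>S\<close>.
\<close>

definition pi1_injects :: "csphere set \<Rightarrow> csphere set \<Rightarrow> bool" where
  "pi1_injects S T \<longleftrightarrow> S \<subseteq> T \<and>
     (\<forall>p q. pathin (subtopology riemann_sphere S) p \<and> pathin (subtopology riemann_sphere S) q \<and>
            p 0 = p 1 \<and> q 0 = q 1 \<and> p 0 = q 0 \<and> sphere_homotopic_paths T p q
            \<longrightarrow> sphere_homotopic_paths S p q)"

definition essential_curve :: "csphere set \<Rightarrow> csphere set \<Rightarrow> bool" where
  "essential_curve A C \<longleftrightarrow>
     jordan_curve C \<and> C \<subseteq> riemann_sphere interior_of A \<and> pi1_injects C A"

text \<open>The component of the complement of \<open>S\<close> that contains infinity.\<close>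

definition outside_of :: "csphere set \<Rightarrow> csphere set" where
  "outside_of S = connected_component_of_set (subtopology riemann_sphere (- S)) None"

text \<open>
  The rest of the complement. For an annulus this is the bounded component, because
  \<open>annuli\<close> below requires it to be a disc.
\<close>

definition inside_of :: "csphere set \<Rightarrow> csphere set" where
  "inside_of S = - (S \<union> outside_of S)"

definition annuli :: "csphere set set" where
  "annuli =
     {A. (\<exists>U. open_annulus U \<and> A = riemann_sphere closure_of U) \<and>
         (\<exists>r>0. A \<inter> exterior_disc r = {}) \<and>
         topological_disc (outside_of A) \<and> topological_disc (inside_of A) \<and>
         (\<exists>C. essential_curve A C)}"


section \<open>The choices attached to an annulus\<close>

text \<open>
  \<open>C\<close>, \<open>g\<close> and \<open>e\<close> are the Jordan curve in \<open>A\<close>, the exterior Riemann map onto its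
  unbounded complementary component, and the parameter of the level curve used below.
\<close>

definition admissible_choice ::
    "csphere set \<Rightarrow> csphere set \<Rightarrow> (csphere \<Rightarrow> csphere) \<Rightarrow> real \<Rightarrow> bool" where
  "admissible_choice A C g e \<longleftrightarrow>
     essential_curve A C \<and>
     conformal_iso g (exterior_disc 1) (outside_of C) \<and> g None = None \<and>
     e > 0 \<and> g ` Some ` {z. norm z = 1 + e} \<subseteq> riemann_sphere interior_of A"

definition rescaled_map :: "(csphere \<Rightarrow> csphere) \<Rightarrow> real \<Rightarrow> csphere \<Rightarrow> csphere" where
  "rescaled_map g e z = g (map_option (\<lambda>w. complex_of_real (1 + e) * w) z)"

text \<open>
  The coefficient \<open>c\<close> in the expansion \<open>c z + a\<^sub>0 + a\<^sub>1 / z + a\<^sub>2 / z\<^sup>2 + \<dots>\<close>, valid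
  for \<open>\<bar>z\<bar> \<ge> 1\<close>.
\<close>

definition leading_coefficient :: "(csphere \<Rightarrow> csphere) \<Rightarrow> complex" where
  "leading_coefficient h =
     (THE c. \<exists>a :: nat \<Rightarrow> complex. \<forall>z. norm z \<ge> 1 \<longrightarrow>
        (\<lambda>k. a k / z ^ k) sums (the (h (Some z)) - c * z))"

text \<open>
  From here on \<open>\<phi>\<close> and \<open>\<epsilon>\<close> assign to every annulus its exterior Riemann map (before
  rescaling) and its parameter.
\<close>

definition node ::
    "(csphere set \<Rightarrow> csphere \<Rightarrow> csphere) \<Rightarrow> (csphere set \<Rightarrow> real) \<Rightarrow> csphere set \<Rightarrow> nat \<Rightarrow> nat \<Rightarrow> complex"
  where
  "node \<phi> \<epsilon> A n k = the (rescaled_map (\<phi> A) (\<epsilon> A) (Some (exp (2 * of_real pi * \<i> * of_nat k / of_nat n))))"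

definition omega ::
    "(csphere set \<Rightarrow> csphere \<Rightarrow> csphere) \<Rightarrow> (csphere set \<Rightarrow> real) \<Rightarrow> csphere set \<Rightarrow> nat \<Rightarrow> complex poly"
  where
  "omega \<phi> \<epsilon> A n =
     smult (inverse (leading_coefficient (rescaled_map (\<phi> A) (\<epsilon> A)) ^ n))
       (\<Prod>k=1..n. [:- node \<phi> \<epsilon> A n k, 1:])"

text \<open>
  The sums and inverses are taken in the field of rational functions, so that
  zeros and poles of the individual terms are treated correctly.
\<close>

definition Omega ::
    "(csphere set \<Rightarrow> csphere \<Rightarrow> csphere) \<Rightarrow> (csphere set \<Rightarrow> real) \<Rightarrow> csphere set set \<Rightarrow> nat
       \<Rightarrow> complex poly fract"
  where
  "Omega \<phi> \<epsilon> \<AA> n = inverse (\<Sum>A\<in>\<AA>. inverse (to_fract (omega \<phi> \<epsilon> A n) + 1))"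

definition R_map ::
    "(csphere set \<Rightarrow> csphere \<Rightarrow> csphere) \<Rightarrow> (csphere set \<Rightarrow> real) \<Rightarrow> csphere set set \<Rightarrow> nat
       \<Rightarrow> csphere \<Rightarrow> csphere"
  where
  "R_map \<phi> \<epsilon> \<AA> n = rational_map (to_fract [:0, 1:] * Omega \<phi> \<epsilon> \<AA> n)"


section \<open>Collections of annuli\<close>

definition mutually_exterior :: "csphere set set \<Rightarrow> bool" where
  "mutually_exterior \<AA> \<longleftrightarrow>
     (\<forall>A\<in>\<AA>. \<forall>B\<in>\<AA>. A \<noteq> B \<longrightarrow> B \<inter> (A \<union> inside_of A) = {})"

definition union_inside :: "csphere set set \<Rightarrow> csphere set" where
  "union_inside \<AA> = (\<Union>A\<in>\<AA>. inside_of A)"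

definition common_outside :: "csphere set set \<Rightarrow> csphere set" where
  "common_outside \<AA> = (\<Inter>A\<in>\<AA>. outside_of A)"

end

theory Submission
  imports Defs
begin

text \<open>
For a single annulus \<open>A\<close>, put \<open>h(v) = log ((\<phi>\<^sub>A(1/v) - z) v / c\<^sub>A)\<close>, where \<open>\<phi>\<^sub>A\<close> is the
rescaled exterior map. If \<open>z\<close> lies inside the curve of \<open>A\<close>, then \<open>h\<close> is holomorphic on a disc
of radius \<open>\<rho> > 1\<close> and vanishes at \<open>0\<close>. The sum of \<open>h\<close> over the \<open>n\<close>-th roots of unity only sees the Taylor
coefficients whose index is a multiple of \<open>n\<close>, so it is exponentially small in \<open>n\<close>;
exponentiating gives \<open>\<omega>\<^sub>A\<^sub>,\<^sub>n(z) \<longlonglongrightarrow> -1\<close>. If instead \<open>z = \<phi>\<^sub>A(w)\<close> with \<open>\<bar>w\<bar> > 1\<close>,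
the factor \<open>1 - w v\<close> has to be divided out first, and the same argument gives
\<open>\<omega>\<^sub>A\<^sub>,\<^sub>n(z) / (w\<^sup>n - 1) \<longlonglongrightarrow> 1\<close>. The bounds on \<open>h\<close> come from the Borel-Caratheodory inequality,
which needs only an upper bound for the real part, that is, for the modulus of the function under the logarithm. They
are therefore uniform in \<open>z\<close>; see \<open>prod_nth_roots_tendsto_1\<close>, \<open>W_tendsto_inside\<close> and
\<open>W_large_outside\<close>.

To use this, the bounded side of \<open>A\<close> must lie inside the chosen curve \<open>C\<close>
and the unbounded side must lie in \<open>\<phi>\<^sub>A({\<bar>w\<bar> \<ge> 1 + \<delta>})\<close> for some \<open>\<delta> > 0\<close>. The first point is where
\<open>\<pi>\<^sub>1\<close>-injectivity enters: otherwise everything inside \<open>C\<close> would belong to \<open>A\<close>, and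
\<open>C\<close> would lie in a simply connected subset of \<open>A\<close> and be null-homotopic there
(\<open>essential_curve_separates\<close>). The second is a connectedness argument
(\<open>outside_of_in_exterior\<close>). Together they give \<open>omega_asymptotics\<close>: uniformly, \<open>\<omega>\<^sub>A\<^sub>,\<^sub>n + 1\<close> is small on the
bounded side and large on the unbounded side.

Now translate so that \<open>t = 0\<close>. For mutually exterior annuli the bounded side of one lies in the unbounded
sides of all the others. At a point of the bounded side of \<open>A\<^sub>i\<close> the sum \<open>\<Sum>\<^sub>j 1 / (\<omega>\<^sub>j + 1)\<close> is dominated by its
\<open>i\<close>-th term and huge, so \<open>R(z) = z \<Omega>(z)\<close> is close to \<open>0\<close>, hence again in a bounded side:
the union of the bounded sides is forward invariant. On the common outside all terms are small,
\<open>\<bar>R(z)\<bar> \<ge> K \<bar>z\<bar>\<close> with \<open>K\<close> large, and \<open>z\<close> stays away from \<open>0\<close>; hence \<open>R(z)\<close> is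
again in the common outside and the orbit escapes (\<open>R_map_dynamics\<close>). The same estimate near infinity
shows that the multiplier there is \<open>0\<close>. The statements on the Julia set are then
topology: the annuli are what remains of the sphere, and a path into the bounded side of
\<open>A\<^sub>i\<close> that starts outside must leave the disjoint closed filled annuli, that is, meet the common outside.
\<close>

section \<open>Sums and products over roots of unity\<close>

text \<open>
Since \<open>Re H < A\<close>, the point \<open>H v\<close> is nearer to \<open>0\<close> than to \<open>2 A\<close>, so the Moebius image \<open>H / (2 A - H)\<close> maps
into the unit disc and the Schwarz lemma applies to it.
\<close>

lemma Borel_Caratheodory:
  fixes H :: "complex \<Rightarrow> complex"
  assumes holH: "H holomorphic_on ball 0 R" and H0: "H 0 = 0"
    and re: "\<And>v. v \<in> ball 0 R \<Longrightarrow> Re (H v) < A" and v: "norm v < R"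
  shows "norm (H v) \<le> 2 * A * norm v / (R - norm v)"
proof -
  have R: "R > 0" using v by (metis norm_ge_zero order_le_less_trans)
  have A: "A > 0" using re[of 0] R H0 by simp
  define f where "f u = H (of_real R * u) / (2 * of_real A - H (of_real R * u))" for u
  have dom: "of_real R * u \<in> ball 0 R" if "norm u < 1" for u :: complex
    using that R by (simp add: norm_mult)
  have ne: "2 * of_real A - H (of_real R * u) \<noteq> 0" if "norm u < 1" for u :: complex
  proof
    assume "2 * of_real A - H (of_real R * u) = 0"
    then have "H (of_real R * u) = of_real (2 * A)" by simp
    then have "Re (H (of_real R * u)) = 2 * A" by (metis Re_complex_of_real)
    with re[OF dom[OF that]] A show False by simp
  qed
  have "f holomorphic_on ball 0 1"
  proof -
    have "(H \<circ> (\<lambda>u. of_real R * u)) holomorphic_on ball 0 1"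
      by (rule holomorphic_on_compose_gen[OF _ holH]) (use dom in \<open>auto intro!: holomorphic_intros\<close>)
    then have "(\<lambda>u. H (of_real R * u)) holomorphic_on ball 0 1" by (simp add: o_def)
    then show ?thesis unfolding f_def using ne by (auto intro!: holomorphic_intros)
  qed
  moreover have "f 0 = 0" by (simp add: f_def H0)
  moreover have "norm (f u) < 1" if u: "norm u < 1" for u
  proof -
    let ?h = "H (of_real R * u)"
    have "(norm ?h)\<^sup>2 < (norm (2 * of_real A - ?h))\<^sup>2"
    proof -
      have "(norm (2 * of_real A - ?h))\<^sup>2 = (norm ?h)\<^sup>2 + 4 * A * (A - Re ?h)"
        unfolding cmod_power2 by (simp add: power2_eq_square algebra_simps)
      moreover have "4 * A * (A - Re ?h) > 0" using re[OF dom[OF u]] A by simp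
      ultimately show ?thesis by linarith
    qed
    then have "norm ?h < norm (2 * of_real A - ?h)" by (simp add: power2_less_imp_less)
    then show ?thesis using ne[OF u] by (simp add: f_def norm_divide)
  qed
  moreover have nv: "norm (v / of_real R) < 1" using v R by (simp add: norm_divide)
  ultimately have S: "norm (f (v / of_real R)) \<le> norm (v / of_real R)"
    using Schwarz_Lemma(1) by blast
  have eq: "of_real R * (v / of_real R) = v" using R by simp
  have "norm (H v) \<le> norm v / R * norm (2 * of_real A - H v)"
    using S ne[OF nv] R unfolding f_def eq by (simp add: norm_divide field_simps)
  also have "\<dots> \<le> norm v / R * (2 * A + norm (H v))"
    using norm_triangle_ineq4[of "2 * of_real A" "H v"] A R
    by (intro mult_left_mono) (auto simp: norm_mult)
  finally show ?thesis using v R by (simp add: field_simps)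
qed

abbreviation nth_root :: "nat \<Rightarrow> nat \<Rightarrow> complex" where
  "nth_root n k \<equiv> exp (2 * of_real pi * \<i> * of_nat k / of_nat n)"

lemma norm_nth_root [simp]: "norm (nth_root n k) = 1"
proof -
  have "nth_root n k = exp (\<i> * of_real (2 * pi * k / n))" by (simp add: field_simps)
  then show ?thesis by (metis norm_exp_i_times)
qed

lemma nth_root_pow_n: "n \<ge> 1 \<Longrightarrow> nth_root n k ^ n = 1"
  using complex_root_unity[of n k] by simp

lemma nth_root_eq_1_iff: "n \<ge> 1 \<Longrightarrow> nth_root n j = 1 \<longleftrightarrow> n dvd j"
  using complex_root_unity_eq_1[of n j] by simp

text \<open>
Both sides are monic polynomials of degree \<open>n\<close> in \<open>x\<close> that vanish at the \<open>n\<close> roots of unity.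
\<close>

lemma prod_diff_nth_root:
  assumes n: "n \<ge> 1"
  shows "(\<Prod>k=1..n. x - nth_root n k) = x ^ n - 1"
proof -
  let ?p = "\<Prod>k=1..n. [:- nth_root n k, 1:]"
  let ?q = "monom 1 n - 1 :: complex poly"
  have inj: "inj_on (nth_root n) {1..n}"
  proof (rule inj_onI)
    fix i j assume ij: "i \<in> {1..n}" "j \<in> {1..n}" "nth_root n i = nth_root n j"
    then have "i mod n = j mod n"
      using complex_root_unity_eq[of n i j] n by (simp add: cong_def)
    with ij(1,2) show "i = j"
      by (metis atLeastAtMost_iff le_neq_implies_less mod_less mod_self not_one_le_zero)
  qed
  have "?p = ?q"
  proof (rule ccontr)
    assume neq: "?p \<noteq> ?q"
    have degp: "degree ?p = n" by (subst degree_prod_eq_sum_degree) auto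
    have lp: "lead_coeff ?p = 1" by (simp add: lead_coeff_prod)
    have "degree (?p - ?q) < n"
    proof -
      have "coeff (?p - ?q) n = 0" using lp degp n by simp
      moreover have "degree (?p - ?q) \<le> n"
        using degp by (intro degree_diff_le) (auto simp: degree_monom_le)
      moreover have "?p - ?q \<noteq> 0" using neq by simp
      ultimately show ?thesis
        by (metis leading_coeff_0_iff order_le_imp_less_or_eq)
    qed
    moreover have "n \<le> card {x. poly (?p - ?q) x = 0}"
    proof -
      have "nth_root n ` {1..n} \<subseteq> {x. poly (?p - ?q) x = 0}"
        proof (rule image_subsetI)
        fix k assume k: "k \<in> {1..n}"
        then have "poly ?p (nth_root n k) = 0"
          unfolding poly_prod by (intro prod_zero) (auto intro!: bexI[of _ k])
        then show "nth_root n k \<in> {x. poly (?p - ?q) x = 0}"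
          using n by (simp add: poly_monom nth_root_pow_n)
      qed
      then have "card (nth_root n ` {1..n}) \<le> card {x. poly (?p - ?q) x = 0}"
        using neq by (intro card_mono poly_roots_finite) auto
      then show ?thesis using inj by (simp add: card_image)
    qed
    ultimately show False
      using card_poly_roots_bound[of "?p - ?q"] neq by simp
  qed
  then have "poly ?p x = poly ?q x" by simp
  then show ?thesis by (simp add: poly_prod poly_monom)
qed

lemma sum_power_inverse_nth_root:
  assumes n: "n \<ge> 1" and j: "\<not> n dvd j"
  shows "(\<Sum>k=1..n. inverse (nth_root n k) ^ j) = 0"
proof -
  let ?x = "inverse (nth_root n j)"
  have "(\<Sum>k=1..n. inverse (nth_root n k) ^ j) = (\<Sum>k=1..n. ?x ^ k)"
  proof (rule sum.cong)
    fix k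
    have "nth_root n k ^ j = nth_root n j ^ k"
      by (simp add: exp_of_nat_mult[symmetric] field_simps)
    then show "inverse (nth_root n k) ^ j = ?x ^ k"
      by (simp add: power_inverse)
  qed simp
  also have "\<dots> = ?x * (\<Sum>k<n. ?x ^ k)"
    by (simp add: sum_distrib_left sum.atLeast1_atMost_eq)
  also have "\<dots> = 0"
  proof -
    have "?x \<noteq> 1" using nth_root_eq_1_iff[OF n, of j] j by simp
    moreover have "?x ^ n = 1" using nth_root_pow_n[OF n, of j] by (simp add: power_inverse)
    ultimately show ?thesis by (simp add: geometric_sum)
  qed
  finally show ?thesis .
qed

text \<open>
Summing the power series of \<open>H\<close> over the roots of unity keeps only the coefficients whose index is
a multiple of \<open>n\<close>. The constant one is zero, so the sum starts at index \<open>n\<close>, where Cauchy's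
inequality makes the coefficients small.
\<close>

lemma norm_sum_nth_roots_le:
  fixes H :: "complex \<Rightarrow> complex"
  assumes holH: "H holomorphic_on ball 0 R" and H0: "H 0 = 0" and s: "1 < s" "s < R"
    and bd: "\<And>v. norm v = s \<Longrightarrow> norm (H v) \<le> M" and n: "n \<ge> 1"
  shows "norm (\<Sum>k=1..n. H (inverse (nth_root n k))) \<le> of_nat n * M * inverse s ^ n / (1 - inverse s)"
proof -
  define a where "a j = (deriv ^^ j) H 0 / fact j" for j
  define q where "q = inverse s"
  have q: "0 < q" "q < 1" using s by (auto simp: q_def inverse_less_1_iff)
  have M: "0 \<le> M" using bd[of "of_real s"] s norm_ge_zero[of "H (of_real s)"] by (smt (verit) norm_of_real)
  have a0: "a 0 = 0" by (simp add: a_def H0)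
  have an: "norm (a j) \<le> M * q ^ j" for j
  proof -
    have "norm ((deriv ^^ j) H 0) \<le> fact j * M / s ^ j"
    proof (rule Cauchy_inequality)
      show "H holomorphic_on ball 0 s" using holH s by (meson holomorphic_on_subset less_imp_le subset_ball)
      show "continuous_on (cball 0 s) H"
        using holH s by (intro holomorphic_on_imp_continuous_on) (auto elim: holomorphic_on_subset)
    qed (use s bd in auto)
    then show ?thesis by (simp add: a_def q_def norm_divide power_inverse field_simps)
  qed
  define T where "T j = (\<Sum>k=1..n. inverse (nth_root n k) ^ j)" for j
  have "(\<lambda>j. a j * inverse (nth_root n k) ^ j) sums H (inverse (nth_root n k))" for k
    using holomorphic_power_series[OF holH, of "inverse (nth_root n k)"] s
    by (simp add: a_def norm_inverse)
  then have "(\<lambda>j. \<Sum>k=1..n. a j * inverse (nth_root n k) ^ j) sums (\<Sum>k=1..n. H (inverse (nth_root n k)))"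
    by (intro sums_sum)
  then have sm: "(\<lambda>j. a j * T j) sums (\<Sum>k=1..n. H (inverse (nth_root n k)))"
    by (simp add: T_def sum_distrib_left)
  have Tn: "norm (T j) \<le> of_nat n" for j
  proof -
    have "norm (T j) \<le> (\<Sum>k=1..n. norm (inverse (nth_root n k) ^ j))"
      unfolding T_def by (rule norm_sum)
    then show ?thesis by (simp add: norm_power norm_inverse)
  qed
  have zero: "a j * T j = 0" if "j < n" for j
  proof (cases "j = 0")
    case False
    then have "\<not> n dvd j" using that by (auto dest: dvd_imp_le)
    then show ?thesis using sum_power_inverse_nth_root[OF n] by (simp add: T_def)
  qed (simp add: a0)
  have sm': "(\<lambda>j. a (j + n) * T (j + n)) sums (\<Sum>k=1..n. H (inverse (nth_root n k)))"
    using sums_split_initial_segment[OF sm, of n] zero by simp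
  have le: "norm (a (j + n) * T (j + n)) \<le> of_nat n * M * q ^ n * q ^ j" for j
  proof -
    have "norm (a (j + n) * T (j + n)) \<le> (M * q ^ (j + n)) * of_nat n"
      unfolding norm_mult using an Tn M q by (intro mult_mono) auto
    then show ?thesis by (simp add: power_add algebra_simps)
  qed
  have g: "(\<lambda>j. of_nat n * M * q ^ n * q ^ j) sums (of_nat n * M * q ^ n * (1 / (1 - q)))"
    using q by (intro sums_mult geometric_sums) auto
  have "norm (\<Sum>k=1..n. H (inverse (nth_root n k))) \<le> of_nat n * M * q ^ n * (1 / (1 - q))"
    unfolding sums_unique[OF sm'] sums_unique[OF g]
    by (rule norm_suminf_le[OF le sums_summable[OF g]])
  then show ?thesis by (simp add: q_def)
qed

text \<open>
The threshold \<open>N\<close> depends only on \<open>R\<close>, \<open>B\<close> and \<open>\<eta>\<close>. This uniformity over all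
functions \<open>E\<close> is what later makes the convergence uniform in the point at which the node polynomials are evaluated.
\<close>

lemma prod_nth_roots_tendsto_1:
  fixes R B \<eta> :: real
  assumes R: "1 < R" and \<eta>: "0 < \<eta>"
  shows "\<exists>N\<ge>1. \<forall>n\<ge>N. \<forall>E. E holomorphic_on ball 0 R \<and> E 0 = 1 \<and>
     (\<forall>v\<in>ball 0 R. E v \<noteq> 0 \<and> norm (E v) \<le> B) \<longrightarrow>
     norm ((\<Prod>k=1..n. E (inverse (nth_root n k))) - 1) < \<eta>"
proof -
  define s where "s = (1 + R) / 2"
  have s: "1 < s" "s < R" using R by (auto simp: s_def)
  define A where "A = ln B + 1"
  define M where "M = 2 * A * s / (R - s)"
  obtain d where d: "d > 0" "\<And>x::complex. norm x < d \<Longrightarrow> norm (exp x - 1) < \<eta>"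
  proof -
    have "isCont (exp :: complex \<Rightarrow> complex) 0" by simp
    then show thesis using \<eta> that unfolding continuous_at_eps_delta by (auto simp: dist_norm)
  qed
  have "(\<lambda>n. of_nat n * M * inverse s ^ n / (1 - inverse s)) \<longlonglongrightarrow> 0"
  proof -
    have "(\<lambda>n. of_nat n * inverse s ^ n) \<longlonglongrightarrow> (0::real)"
      using s by (intro powser_times_n_limit_0) (auto simp: inverse_less_1_iff)
    then have "(\<lambda>n. (M / (1 - inverse s)) * (of_nat n * inverse s ^ n)) \<longlonglongrightarrow> 0"
      by (rule tendsto_mult_right_zero)
    then show ?thesis by (simp add: field_simps)
  qed
  then have "eventually (\<lambda>n. of_nat n * M * inverse s ^ n / (1 - inverse s) < d) sequentially"
    using d(1) by (auto dest: order_tendstoD)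
  then obtain N where N: "\<And>n. n \<ge> N \<Longrightarrow> of_nat n * M * inverse s ^ n / (1 - inverse s) < d"
    by (auto simp: eventually_sequentially)
  show ?thesis
  proof (intro exI[of _ "max 1 N"] conjI allI impI)
    fix n E
    assume n: "max 1 N \<le> n" and "E holomorphic_on ball 0 R \<and> E 0 = 1 \<and>
       (\<forall>v\<in>ball 0 R. E v \<noteq> 0 \<and> norm (E v) \<le> B)"
    then have E: "E holomorphic_on ball 0 R" "E 0 = 1" "\<And>v. v \<in> ball 0 R \<Longrightarrow> E v \<noteq> 0"
      "\<And>v. v \<in> ball 0 R \<Longrightarrow> norm (E v) \<le> B" by auto
    obtain h where h: "h holomorphic_on ball 0 R" "\<And>v. v \<in> ball 0 R \<Longrightarrow> E v = exp (h v)"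
      using contractible_imp_holomorphic_log[OF E(1) _ E(3)]
      by (metis convex_ball convex_imp_contractible)
    define H where "H v = h v - h 0" for v
    have H: "H holomorphic_on ball 0 R" "H 0 = 0"
      unfolding H_def using h by (auto intro!: holomorphic_intros)
    have EH: "E v = exp (H v)" if "v \<in> ball 0 R" for v
      using h(2)[OF that] h(2)[of 0] E(2) R by (simp add: H_def exp_diff)
    have re: "Re (H v) < A" if "v \<in> ball 0 R" for v
    proof -
      have "exp (Re (H v)) \<le> B" using E(4)[OF that] EH[OF that] by simp
      then have "Re (H v) \<le> ln B" by (metis exp_gt_zero ln_exp ln_mono)
      then show ?thesis by (simp add: A_def)
    qed
    have bd: "norm (H v) \<le> M" if "norm v = s" for v
      using Borel_Caratheodory[OF H re, of v] that s by (simp add: M_def)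
    have "norm (\<Sum>k=1..n. H (inverse (nth_root n k))) \<le> of_nat n * M * inverse s ^ n / (1 - inverse s)"
      using norm_sum_nth_roots_le[OF H s bd] n by simp
    also have "\<dots> < d" using N n by simp
    finally have "norm (exp (\<Sum>k=1..n. H (inverse (nth_root n k))) - 1) < \<eta>" by (rule d(2))
    moreover have "exp (\<Sum>k=1..n. H (inverse (nth_root n k))) = (\<Prod>k=1..n. E (inverse (nth_root n k)))"
      using R by (simp add: exp_sum EH norm_inverse)
    ultimately show "norm ((\<Prod>k=1..n. E (inverse (nth_root n k))) - 1) < \<eta>" by simp
  qed simp
qed

section \<open>Polynomials with nodes on an analytic curve\<close>

text \<open>
\<open>F\<close> encodes a map \<open>\<psi> w = w F(1/w)\<close> that is univalent on \<open>{\<bar>w\<bar> > 1/\<rho>}\<close> with a simple pole at infinity.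
Working with \<open>F\<close> on a disc avoids holomorphy at the point at infinity, and \<open>F 0\<close> is
the leading coefficient of \<open>\<psi>\<close>.
\<close>

locale exterior_map =
  fixes F :: "complex \<Rightarrow> complex" and \<rho> :: real
  assumes rho: "1 < \<rho>"
    and holF: "F holomorphic_on ball 0 \<rho>"
    and F0: "F 0 \<noteq> 0"
    and inj: "inj_on (\<lambda>w. w * F (inverse w)) {w. inverse \<rho> < norm w}"
begin

definition \<psi> :: "complex \<Rightarrow> complex" where
  "\<psi> w = w * F (inverse w)"

definition W :: "nat \<Rightarrow> complex \<Rightarrow> complex" where
  "W n z = inverse (F 0 ^ n) * (\<Prod>k=1..n. z - \<psi> (nth_root n k))"

lemma norm_inverse_less: "(v::complex) \<in> ball 0 \<rho> \<Longrightarrow> v \<noteq> 0 \<Longrightarrow> inverse \<rho> < norm (inverse v)"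
  using rho by (simp add: norm_inverse less_imp_inverse_less)

lemma W_eq: "W n z = (\<Prod>k=1..n. (z - \<psi> (nth_root n k)) / F 0)"
  by (simp add: W_def prod_dividef field_simps)

text \<open>
For \<open>v = 1/u\<close> with \<open>u\<close> a node parameter, \<open>(z - \<psi> u) / F 0 = - u E(v)\<close> with
\<open>E(v) = (F v - z v) / F 0\<close>. A zero of \<open>E\<close> would be a preimage of \<open>z\<close> under \<open>\<psi>\<close>, so \<open>E\<close> is zero-free, and
\<open>\<Prod> (- u) = -1\<close> accounts for the limit.
\<close>

lemma W_tendsto_inside:
  assumes \<eta>: "0 < \<eta>"
  shows "\<exists>N\<ge>1. \<forall>n\<ge>N. \<forall>z. norm z \<le> B \<and> z \<notin> \<psi> ` {w. inverse \<rho> < norm w} \<longrightarrow> norm (W n z + 1) < \<eta>"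
proof -
  define R where "R = (1 + \<rho>) / 2"
  have R: "1 < R" "R < \<rho>" using rho by (auto simp: R_def)
  have sub: "cball 0 R \<subseteq> ball 0 \<rho>" "ball 0 R \<subseteq> ball 0 \<rho>" using R by auto
  have "compact (F ` cball 0 R)"
    using holF sub by (intro compact_continuous_image holomorphic_on_imp_continuous_on)
      (auto elim: holomorphic_on_subset)
  then obtain K where K: "\<And>v. v \<in> cball 0 R \<Longrightarrow> norm (F v) \<le> K"
    using compact_imp_bounded bounded_iff by (metis imageI)
  define C where "C = (K + B * R) / norm (F 0)"
  obtain N where N: "N \<ge> 1" "\<And>n E. n \<ge> N \<Longrightarrow> E holomorphic_on ball 0 R \<Longrightarrow> E 0 = 1 \<Longrightarrow>
     (\<And>v. v\<in>ball 0 R \<Longrightarrow> E v \<noteq> 0 \<and> norm (E v) \<le> C) \<Longrightarrow>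
     norm ((\<Prod>k=1..n. E (inverse (nth_root n k))) - 1) < \<eta>"
    using prod_nth_roots_tendsto_1[OF R(1) \<eta>, of C] by blast
  show ?thesis
  proof (intro exI[of _ N] conjI allI impI)
    fix n z assume n: "N \<le> n" and "norm z \<le> B \<and> z \<notin> \<psi> ` {w. inverse \<rho> < norm w}"
    then have z: "norm z \<le> B" "z \<notin> \<psi> ` {w. inverse \<rho> < norm w}" by auto
    define E where "E v = (F v - z * v) / F 0" for v
    have "E holomorphic_on ball 0 R"
      unfolding E_def using holF sub F0 by (auto intro!: holomorphic_intros elim: holomorphic_on_subset)
    moreover have "E 0 = 1" using F0 by (simp add: E_def)
    moreover have "E v \<noteq> 0 \<and> norm (E v) \<le> C" if v: "v \<in> ball 0 R" for v
    proof
      show "E v \<noteq> 0"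
      proof (cases "v = 0")
        case False
        have "\<psi> (inverse v) \<noteq> z" using z(2) norm_inverse_less[of v] v False sub by blast
        then have "F v \<noteq> z * v" using False by (auto simp: \<psi>_def)
        then show ?thesis using F0 by (simp add: E_def)
      qed (use F0 in \<open>simp add: E_def\<close>)
      have "norm (F v - z * v) \<le> K + B * R"
      proof -
        have "norm (z * v) \<le> B * R"
          unfolding norm_mult using z(1) v order_trans[OF norm_ge_zero z(1)] by (intro mult_mono) auto
        moreover have "norm (F v) \<le> K" using K v by simp
        ultimately show ?thesis using norm_triangle_ineq4[of "F v" "z * v"] by linarith
      qed
      then show "norm (E v) \<le> C" by (simp add: E_def C_def norm_divide divide_right_mono)
    qed
    ultimately have le: "norm ((\<Prod>k=1..n. E (inverse (nth_root n k))) - 1) < \<eta>" by (rule N(2)[OF n])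
    have "W n z = (\<Prod>k=1..n. (0 - nth_root n k) * E (inverse (nth_root n k)))"
      unfolding W_eq
    proof (rule prod.cong)
      fix k
      show "(z - \<psi> (nth_root n k)) / F 0 = (0 - nth_root n k) * E (inverse (nth_root n k))"
        using F0 by (simp add: E_def \<psi>_def field_simps)
    qed simp
    also have "\<dots> = - (\<Prod>k=1..n. E (inverse (nth_root n k)))"
      using prod_diff_nth_root[of n 0] n N(1) unfolding prod.distrib by (simp add: power_0_left)
    finally have "W n z + 1 = - ((\<Prod>k=1..n. E (inverse (nth_root n k))) - 1)" by simp
    then show "norm (W n z + 1) < \<eta>" using le by (simp add: norm_minus_commute)
  qed (rule N(1))
qed

text \<open>
Now \<open>z = \<psi> w\<close> is attained, so \<open>F v - z v\<close> has a zero at \<open>v0 = 1/w\<close>; it has to be divided out together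
with the factor \<open>1 - w v\<close>. What remains is \<open>E(v) = (F v0 - v0 D(v)) / F 0\<close>, with \<open>D\<close> the difference quotient
of \<open>F\<close> at \<open>v0\<close>; in this form a bound uniform in \<open>w\<close> is visible. The divided factors multiply up to \<open>w\<^sup>n - 1\<close>.
\<close>

lemma W_large_outside:
  assumes \<delta>: "0 < \<delta>"
  shows "\<exists>N\<ge>1. \<forall>n\<ge>N. \<forall>w. 1 + \<delta> \<le> norm w \<longrightarrow> M \<le> norm (W n (\<psi> w))"
proof -
  define R where "R = (1 + \<rho>) / 2"
  have R: "1 < R" "R < \<rho>" using rho by (auto simp: R_def)
  have sub: "cball 0 R \<subseteq> ball 0 \<rho>" "ball 0 R \<subseteq> ball 0 \<rho>" using R by auto
  have "compact (F ` cball 0 R)"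
    using holF sub by (intro compact_continuous_image holomorphic_on_imp_continuous_on)
      (auto elim: holomorphic_on_subset)
  then obtain K where K: "\<And>v. v \<in> cball 0 R \<Longrightarrow> norm (F v) \<le> K"
    using compact_imp_bounded bounded_iff by (metis imageI)
  have "compact (deriv F ` cball 0 R)"
    using holomorphic_deriv[OF holF] sub by (intro compact_continuous_image holomorphic_on_imp_continuous_on)
      (auto elim: holomorphic_on_subset)
  then obtain K' where K': "\<And>v. v \<in> cball 0 R \<Longrightarrow> norm (deriv F v) \<le> K'"
    using compact_imp_bounded bounded_iff by (metis imageI)
  define C where "C = (K + K') / norm (F 0)"
  obtain N where N: "N \<ge> 1" "\<And>n E. n \<ge> N \<Longrightarrow> E holomorphic_on ball 0 R \<Longrightarrow> E 0 = 1 \<Longrightarrow>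
     (\<And>v. v\<in>ball 0 R \<Longrightarrow> E v \<noteq> 0 \<and> norm (E v) \<le> C) \<Longrightarrow>
     norm ((\<Prod>k=1..n. E (inverse (nth_root n k))) - 1) < 1/2"
    using prod_nth_roots_tendsto_1[OF R(1), of "1/2" C] by auto
  obtain N' where "2 * M + 1 < (1 + \<delta>) ^ N'"
    using real_arch_pow[of "1 + \<delta>" "2 * M + 1"] \<delta> by auto
  then have N': "2 * M + 1 \<le> (1 + \<delta>) ^ n" if "n \<ge> N'" for n
    using power_increasing[OF that, of "1 + \<delta>"] \<delta> by linarith
  show ?thesis
  proof (intro exI[of _ "max N N'"] conjI allI impI)
    fix n and w0 :: complex assume n: "max N N' \<le> n" and w0: "1 + \<delta> \<le> norm w0"
    define v0 where "v0 = inverse w0"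
    have w0_0: "w0 \<noteq> 0" "1 < norm w0" using w0 \<delta> by auto
    then have v0: "v0 \<noteq> 0" "norm v0 < 1" by (auto simp: v0_def norm_inverse inverse_less_1_iff)
    have v0R: "v0 \<in> ball 0 R" "v0 \<in> cball 0 R" "v0 \<in> ball 0 \<rho>" using v0 R by auto
    define D where "D v = (if v = v0 then deriv F v0 else (F v - F v0) / (v - v0))" for v
    define E where "E v = (F v0 - v0 * D v) / F 0" for v
    have holD: "D holomorphic_on ball 0 R"
      unfolding D_def using holF sub
      by (intro pole_lemma_open) (auto elim: holomorphic_on_subset)
    then have "E holomorphic_on ball 0 R"
      unfolding E_def using F0 by (auto intro!: holomorphic_intros)
    moreover have "E 0 = 1" using F0 v0 by (simp add: E_def D_def)
    moreover have "E v \<noteq> 0 \<and> norm (E v) \<le> C" if v: "v \<in> ball 0 R" for v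
    proof
      have key: "F 0 * E v * (v - v0) = v * F v0 - v0 * F v" if "v \<noteq> v0"
        using that F0 by (simp add: E_def D_def field_simps)
      show "E v \<noteq> 0"
      proof (cases "v = v0")
        case True
        \<comment> \<open>At \<open>v0\<close> the numerator of \<open>E\<close> is the derivative of \<open>\<psi>\<close> at \<open>w0\<close>, nonzero by univalence.\<close>
        have opn: "open {w::complex. inverse \<rho> < norm w}" by (intro open_Collect_less continuous_intros)
        have hol: "(\<lambda>w. w * F (inverse w)) holomorphic_on {w. inverse \<rho> < norm w}"
        proof -
          have "(F \<circ> inverse) holomorphic_on {w. inverse \<rho> < norm w}"
          proof (rule holomorphic_on_compose_gen[OF _ holF])
            show "inverse holomorphic_on {w::complex. inverse \<rho> < norm w}"
              using rho by (auto intro!: holomorphic_intros)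
            show "inverse ` {w::complex. inverse \<rho> < norm w} \<subseteq> ball 0 \<rho>"
            proof (rule image_subsetI)
              fix w :: complex assume "w \<in> {w. inverse \<rho> < norm w}"
              then have "inverse (norm w) < inverse (inverse \<rho>)"
                using rho by (intro less_imp_inverse_less) auto
              then show "inverse w \<in> ball 0 \<rho>" by (simp add: norm_inverse)
            qed
          qed
          then show ?thesis by (auto intro!: holomorphic_intros simp: o_def)
        qed
        have w0m: "w0 \<in> {w. inverse \<rho> < norm w}"
          using norm_inverse_less[OF v0R(3) v0(1)] by (simp add: v0_def)
        have "deriv (\<lambda>w. w * F (inverse w)) w0 \<noteq> 0"
          by (rule holomorphic_injective_imp_regular[OF hol opn inj w0m])
        moreover have "((\<lambda>w. w * F (inverse w)) has_field_derivative (F v0 - v0 * deriv F v0)) (at w0)"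
        proof -
          have "(F has_field_derivative deriv F v0) (at (inverse w0))"
            using holomorphic_derivI[OF holF open_ball v0R(3)] by (simp add: v0_def)
          from DERIV_chain2[OF this DERIV_inverse[OF w0_0(1)]]
          have "((\<lambda>w. F (inverse w)) has_field_derivative deriv F v0 * - (inverse w0 ^ Suc (Suc 0))) (at w0)" .
          from DERIV_mult[OF DERIV_ident this] show ?thesis
            using w0_0 by (simp add: v0_def field_simps)
        qed
        ultimately have "F v0 - v0 * deriv F v0 \<noteq> 0" using DERIV_imp_deriv by fastforce
        then show ?thesis using F0 True by (simp add: E_def D_def)
      next
        case False
        have "v * F v0 \<noteq> v0 * F v"
        proof (cases "v = 0")
          case True then show ?thesis using F0 v0 by simp
        next
          case v: False
          have ne: "inverse v \<noteq> inverse v0" using False by simp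
          have "inverse v \<in> {w. inverse \<rho> < norm w}" "inverse v0 \<in> {w. inverse \<rho> < norm w}"
            using norm_inverse_less[OF v0R(3) v0(1)] norm_inverse_less[of v] v that sub R by auto
          with ne have "inverse v * F (inverse (inverse v)) \<noteq> inverse v0 * F (inverse (inverse v0))"
            using inj_onD[OF inj] by blast
          then show ?thesis using v v0 by (simp add: field_simps)
        qed
        then show ?thesis using key False by auto
      qed
      have "norm (D v) \<le> K'"
      proof (cases "v = v0")
        case True then show ?thesis using K' v0R by (simp add: D_def)
      next
        case False
        have "norm (F v - F v0) \<le> K' * norm (v - v0)"
        proof (rule field_differentiable_bound[of "ball 0 R" F "deriv F"])
          show "(F has_field_derivative deriv F z) (at z within ball 0 R)" if "z \<in> ball 0 R" for z
            using holomorphic_derivI[OF holF open_ball, of z] that sub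
            by (blast intro: has_field_derivative_at_within)
        qed (use K' v v0R in auto)
        then show ?thesis using False by (simp add: D_def norm_divide field_simps)
      qed
      moreover have "0 \<le> K'" using K'[of 0] R norm_ge_zero[of "deriv F 0"] by (smt (verit) centre_in_cball)
      ultimately have "norm (v0 * D v) \<le> 1 * K'"
        unfolding norm_mult using v0 by (intro mult_mono) auto
      then have "norm (F v0 - v0 * D v) \<le> K + K'"
        using norm_triangle_ineq4[of "F v0" "v0 * D v"] K[OF v0R(2)] by linarith
      then show "norm (E v) \<le> C" by (simp add: E_def C_def norm_divide divide_right_mono)
    qed
    ultimately have le: "norm ((\<Prod>k=1..n. E (inverse (nth_root n k))) - 1) < 1/2"
      using N(2) n by simp
    have "W n (\<psi> w0) = (\<Prod>k=1..n. (w0 - nth_root n k) * E (inverse (nth_root n k)))"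
      unfolding W_eq
    proof (rule prod.cong)
      fix k
      let ?u = "nth_root n k"
      have "?u \<noteq> w0" using w0_0 norm_nth_root[of n k] by auto
      then have "inverse ?u \<noteq> v0" by (auto simp: v0_def)
      then show "(\<psi> w0 - \<psi> ?u) / F 0 = (w0 - ?u) * E (inverse ?u)"
        using F0 w0_0 by (simp add: E_def D_def \<psi>_def v0_def divide_simps) (simp add: algebra_simps)
    qed simp
    also have "\<dots> = (w0 ^ n - 1) * (\<Prod>k=1..n. E (inverse (nth_root n k)))" (is "_ = _ * ?P")
      using prod_diff_nth_root[of n w0] n N(1) unfolding prod.distrib by simp
    finally have eq: "norm (W n (\<psi> w0)) = norm (w0 ^ n - 1) * norm ?P" by (simp add: norm_mult)
    have "1/2 \<le> norm ?P" using le norm_triangle_ineq2[of 1 ?P] by (simp add: norm_minus_commute)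
    moreover have "2 * M \<le> norm (w0 ^ n - 1)"
    proof -
      have "2 * M + 1 \<le> (1 + \<delta>) ^ n" using N' n by simp
      also have "\<dots> \<le> norm w0 ^ n" using w0 \<delta> by (intro power_mono) auto
      finally show ?thesis using norm_triangle_ineq2[of "w0 ^ n" 1] by (simp add: norm_power)
    qed
    ultimately have "norm (w0 ^ n - 1) * (1/2) \<le> norm (w0 ^ n - 1) * norm ?P"
      by (intro mult_left_mono) auto
    then show "M \<le> norm (W n (\<psi> w0))" using eq \<open>2 * M \<le> norm (w0 ^ n - 1)\<close> by linarith
  qed (use N(1) in auto)
qed

end

section \<open>The expansion of an exterior Riemann map at infinity\<close>

text \<open>
The coefficient is unique because \<open>h(z)/z\<close> determines it as a limit at infinity.
\<close>

lemma leading_coefficient_eq: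
  fixes F :: "complex \<Rightarrow> complex"
  assumes \<rho>: "1 < \<rho>" and holF: "F holomorphic_on ball 0 \<rho>"
    and h: "\<And>w. 1 \<le> norm w \<Longrightarrow> h (Some w) = Some (w * F (inverse w))"
  shows "leading_coefficient h = F 0"
  unfolding leading_coefficient_def
proof (rule the_equality)
  define a where "a k = (deriv ^^ Suc k) F 0 / fact (Suc k)" for k
  show "\<exists>a. \<forall>z. 1 \<le> norm z \<longrightarrow> (\<lambda>k. a k / z ^ k) sums (the (h (Some z)) - F 0 * z)"
  proof (intro exI[of _ a] allI impI)
    fix z :: complex assume z: "1 \<le> norm z"
    then have z0: "z \<noteq> 0" by auto
    have "norm (inverse z) \<le> 1" using z by (simp add: norm_inverse inverse_le_1_iff)
    then have "inverse z \<in> ball 0 \<rho>" using \<rho> by simp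
    from holomorphic_power_series[OF holF this]
    have "(\<lambda>k. (deriv ^^ k) F 0 / fact k * inverse z ^ k) sums F (inverse z)" by simp
    then have "(\<lambda>k. (deriv ^^ Suc k) F 0 / fact (Suc k) * inverse z ^ Suc k) sums (F (inverse z) - F 0)"
      by (subst sums_Suc_iff) simp
    then have "(\<lambda>k. z * (a k * inverse z ^ Suc k)) sums (z * (F (inverse z) - F 0))"
      unfolding a_def by (rule sums_mult)
    moreover have "z * (a k * inverse z ^ Suc k) = a k / z ^ k" for k
      using z0 by (simp add: field_simps power_inverse)
    ultimately show "(\<lambda>k. a k / z ^ k) sums (the (h (Some z)) - F 0 * z)"
      using h[OF z] by (simp add: algebra_simps)
  qed
next
  fix c assume "\<exists>a. \<forall>z. 1 \<le> norm z \<longrightarrow> (\<lambda>k. a k / z ^ k) sums (the (h (Some z)) - c * z)"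
  then obtain a where a: "\<And>z. 1 \<le> norm z \<Longrightarrow> (\<lambda>k. a k / z ^ k) sums (the (h (Some z)) - c * z)" by blast
  define P where "P v = (\<Sum>k. a k * v ^ k)" for v
  have "summable (\<lambda>k. a k * 1 ^ k)" using sums_summable[OF a[of 1]] by simp
  then have "isCont P 0" unfolding P_def by (rule isCont_powser) simp
  then have "(P \<longlongrightarrow> P 0) (at 0)" by (simp add: isCont_def)
  then have "((\<lambda>v. v * P v) \<longlongrightarrow> 0 * P 0) (at 0)" by (intro tendsto_intros)
  moreover have "eventually (\<lambda>v. v * P v = F v - c) (at 0)"
  proof -
    have "eventually (\<lambda>v::complex. v \<in> ball 0 1 - {0}) (at 0)"
      by (intro eventually_at_in_open) auto
    then show ?thesis
    proof (rule eventually_mono)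
      fix v :: complex assume "v \<in> ball 0 1 - {0}"
      then have v: "v \<noteq> 0" "1 \<le> norm (inverse v)" by (auto simp: norm_inverse one_le_inverse)
      have "(\<lambda>k. a k * v ^ k) sums (inverse v * F v - c * inverse v)"
        using a[OF v(2)] h[OF v(2)] v(1) by (simp add: field_simps power_inverse)
      then have "P v = inverse v * F v - c * inverse v" unfolding P_def by (simp add: sums_iff)
      then show "v * P v = F v - c" using v(1) by (simp add: field_simps)
    qed
  qed
  ultimately have "((\<lambda>v. F v - c) \<longlongrightarrow> 0 * P 0) (at 0)" by (rule Lim_transform_eventually)
  then have "((\<lambda>v. F v - c) \<longlongrightarrow> 0) (at 0)" by simp
  moreover have "((\<lambda>v. F v - c) \<longlongrightarrow> F 0 - c) (at 0)"
  proof -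
    have "isCont F 0" using holF \<rho>
      by (metis centre_in_ball continuous_on_interior holomorphic_on_imp_continuous_on interior_ball
          less_trans zero_less_one)
    then show ?thesis unfolding isCont_def by (intro tendsto_intros)
  qed
  ultimately have "F 0 - c = 0" by (metis tendsto_unique trivial_limit_at)
  then show "c = F 0" by simp
qed

text \<open>
In the coordinate at infinity the map becomes \<open>G(w) = 1/g(1/w)\<close>, injective near \<open>0\<close> with \<open>G(0) = 0\<close>. Hence
\<open>G'(0) \<noteq> 0\<close>, and \<open>F(w) = w/G(w)\<close> extends holomorphically over \<open>0\<close> with a nonzero value.
\<close>

lemma conformal_iso_at_infinity:
  assumes ci: "conformal_iso g (exterior_disc 1) T" and gN: "g None = None"
  obtains F where "F holomorphic_on ball 0 1" "F 0 \<noteq> 0"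
    "\<And>z. 1 < norm z \<Longrightarrow> g (Some z) = Some (z * F (inverse z))"
proof -
  have inj: "inj_on g (exterior_disc 1)" using ci by (simp add: conformal_iso_def bij_betw_def)
  define u where "u z = the (g (Some z))" for z
  have mem: "Some z \<in> exterior_disc 1 \<longleftrightarrow> 1 < norm z" for z by (auto simp: exterior_disc_def)
  have memN: "None \<in> exterior_disc 1" by (auto simp: exterior_disc_def)
  have gS: "g (Some z) = Some (u z)" if "1 < norm z" for z
  proof -
    have "g (Some z) \<noteq> None" using inj_onD[OF inj, of "Some z" None] gN mem[of z] memN that by auto
    then show ?thesis by (simp add: u_def)
  qed
  have uinj: "z = z'" if "1 < norm z" "1 < norm z'" "u z = u z'" for z z'
  proof -
    have "g (Some z) = g (Some z')" using gS[OF that(1)] gS[OF that(2)] that(3) by simp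
    then have "Some z = Some z'" using inj_onD[OF inj] mem that by blast
    then show ?thesis by simp
  qed
  have "\<forall>p\<in>exterior_disc 1. (\<lambda>w. sphere_chart (g p) (g (sphere_param p w))) analytic_on {sphere_chart p p}"
    using ci unfolding conformal_iso_def sphere_holomorphic_on_def by (elim conjE)
  note hol = bspec[OF this]
  have u_an: "u analytic_on {z}" if z: "1 < norm z" for z
  proof -
    have "(\<lambda>w. the (g (Some w))) analytic_on {z}"
      using hol[of "Some z"] mem[of z] z gS[OF z] by (simp add: sphere_chart_def sphere_param_def)
    then show ?thesis by (simp add: u_def[abs_def])
  qed
  define G where "G w = the (sphere_inverse (g (sphere_inverse (Some w))))" for w
  have G_an: "G analytic_on {0}"
    using hol[OF memN] gN by (simp add: sphere_chart_def sphere_param_def G_def[abs_def] sphere_inverse_def)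
  have G0: "G 0 = 0" by (simp add: G_def sphere_inverse_def gN)
  have inv1: "1 < norm (inverse w)" if "w \<noteq> 0" "norm w < 1" for w :: complex
    using that by (simp add: norm_inverse one_less_inverse)
  have Gw: "G w = inverse (u (inverse w))" if "w \<noteq> 0" "norm w < 1" "u (inverse w) \<noteq> 0" for w
    using that gS[OF inv1] by (simp add: G_def sphere_inverse_def)
  obtain s where s: "0 < s" "s \<le> 1" "G holomorphic_on ball 0 s"
    "\<And>w. w \<in> ball 0 s \<Longrightarrow> w \<noteq> 0 \<Longrightarrow> u (inverse w) \<noteq> 0"
  proof -
    (* G takes a default value at the possible zero of u, so the disc has to stop short of that point. *)
    obtain s1 where s1: "s1 > 0" "G holomorphic_on ball 0 s1"
      using G_an by (auto simp: analytic_on_def)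
    show thesis
    proof (cases "\<exists>w. w \<noteq> 0 \<and> norm w < 1 \<and> u (inverse w) = 0")
      case True
      then obtain w1 where w1: "w1 \<noteq> 0" "norm w1 < 1" "u (inverse w1) = 0" by blast
      show thesis
      proof (rule that[of "min s1 (norm w1)"])
        show "G holomorphic_on ball 0 (min s1 (norm w1))"
          using s1(2) by (rule holomorphic_on_subset) auto
        fix w :: complex assume w: "w \<in> ball 0 (min s1 (norm w1))" "w \<noteq> 0"
        show "u (inverse w) \<noteq> 0"
        proof
          assume "u (inverse w) = 0"
          then have "inverse w = inverse w1"
            using uinj[OF inv1 inv1, of w w1] w w1 by auto
          then show False using w by simp
        qed
      qed (use s1 w1 in auto)
    next
      case False
      show thesis
      proof (rule that[of "min s1 1"])
        show "G holomorphic_on ball 0 (min s1 1)"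
          using s1(2) by (rule holomorphic_on_subset) auto
      qed (use s1 False in auto)
    qed
  qed
  have Gne: "G w \<noteq> 0" if "w \<in> ball 0 s" "w \<noteq> 0" for w
    using Gw[of w] s(4)[OF that] that s(2) by auto
  have "inj_on G (ball 0 s)"
  proof (rule inj_onI)
    fix w w' assume w: "w \<in> ball 0 s" "w' \<in> ball 0 s" "G w = G w'"
    show "w = w'"
    proof (cases "w = 0 \<or> w' = 0")
      case True then show ?thesis using Gne[of w] Gne[of w'] w G0 by metis
    next
      case False
      then have "u (inverse w) = u (inverse w')"
        using w Gw[of w] Gw[of w'] s(2) s(4)[of w] s(4)[of w'] by auto
      then show ?thesis using uinj[OF inv1 inv1, of w w'] False w s(2) by auto
    qed
  qed
  then have dG: "deriv G 0 \<noteq> 0"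
    using holomorphic_injective_imp_regular[OF s(3) open_ball] s(1) by simp
  define F where "F v = (if v = 0 then inverse (deriv G 0) else v * u (inverse v))" for v
  have "F holomorphic_on ball 0 1"
  proof (rule no_isolated_singularity'[where K = "{0}"])
    have "(G has_field_derivative deriv G 0) (at 0)"
      using holomorphic_derivI[OF s(3) open_ball] s(1) by simp
    then have "((\<lambda>w. G w / w) \<longlongrightarrow> deriv G 0) (at 0)"
      by (simp add: DERIV_def G0)
    from tendsto_inverse[OF this dG] have lim: "((\<lambda>w. inverse (G w / w)) \<longlongrightarrow> F 0) (at 0)"
      unfolding F_def by (subst if_P) auto
    have "eventually (\<lambda>w. w \<in> ball 0 s - {0}) (at 0)"
      using s(1) by (intro eventually_at_in_open) auto
    then have "eventually (\<lambda>w. inverse (G w / w) = F w) (at 0)"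
      by (rule eventually_mono) (use Gw s in \<open>auto simp: F_def divide_inverse\<close>)
    with lim have "(F \<longlongrightarrow> F 0) (at 0)" by (rule Lim_transform_eventually)
    then show "(F \<longlongrightarrow> F z) (at z within ball 0 1)" if "z \<in> {0}" for z
      using that by (auto intro: tendsto_within_subset[of F _ 0 UNIV])
    show "F holomorphic_on ball 0 1 - {0}"
    proof (rule holomorphic_transform)
      have "u analytic_on {z. 1 < norm z}"
        using u_an by (subst analytic_on_analytic_at) blast
      then have "u holomorphic_on {z. 1 < norm z}" by (rule analytic_imp_holomorphic)
      then have "(u \<circ> inverse) holomorphic_on ball 0 1 - {0}"
        by (rule holomorphic_on_compose_gen[rotated]) (use inv1 in \<open>auto intro!: holomorphic_intros\<close>)
      then show "(\<lambda>v. v * u (inverse v)) holomorphic_on ball 0 1 - {0}"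
        by (auto intro!: holomorphic_intros simp: o_def)
    qed (auto simp: F_def)
  qed auto
  moreover have "F 0 \<noteq> 0" using dG by (simp add: F_def)
  moreover have "g (Some z) = Some (z * F (inverse z))" if "1 < norm z" for z
  proof -
    have "z \<noteq> 0" using that by auto
    then show ?thesis using gS[OF that] by (simp add: F_def)
  qed
  ultimately show thesis by (rule that)
qed

lemma rescaled_map_expansion:
  assumes ci: "conformal_iso g (exterior_disc 1) T" and gN: "g None = None" and e: "0 < e"
  obtains F where "exterior_map F (1 + e)"
    "\<And>w. inverse (1 + e) < norm w \<Longrightarrow> g (Some (of_real (1 + e) * w)) = Some (exterior_map.\<psi> F w)"
    "leading_coefficient (rescaled_map g e) = F 0"
proof -
  obtain F0 where F0: "F0 holomorphic_on ball 0 1" "F0 0 \<noteq> 0"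
    "\<And>z. 1 < norm z \<Longrightarrow> g (Some z) = Some (z * F0 (inverse z))"
    by (rule conformal_iso_at_infinity[OF ci gN]) blast
  define \<rho> where "\<rho> = 1 + e"
  have \<rho>: "1 < \<rho>" using e by (simp add: \<rho>_def)
  define F where "F v = of_real \<rho> * F0 (v / of_real \<rho>)" for v
  have holF: "F holomorphic_on ball 0 \<rho>"
  proof -
    have "(F0 \<circ> (\<lambda>v. v / of_real \<rho>)) holomorphic_on ball 0 \<rho>"
      by (rule holomorphic_on_compose_gen[OF _ F0(1)])
        (use \<rho> in \<open>auto intro!: holomorphic_intros simp: norm_divide\<close>)
    then show ?thesis unfolding F_def by (auto intro!: holomorphic_intros simp: o_def)
  qed
  have gF: "g (Some (of_real \<rho> * w)) = Some (w * F (inverse w))" if "inverse \<rho> < norm w" for w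
  proof -
    have "1 < norm (of_real \<rho> * w)" using that \<rho> by (simp add: norm_mult field_simps)
    from F0(3)[OF this] show ?thesis by (simp add: F_def field_simps)
  qed
  have inj: "inj_on g (exterior_disc 1)" using ci by (simp add: conformal_iso_def bij_betw_def)
  have "inj_on (\<lambda>w. w * F (inverse w)) {w. inverse \<rho> < norm w}"
  proof (rule inj_onI)
    fix w w' assume w: "w \<in> {w. inverse \<rho> < norm w}" "w' \<in> {w. inverse \<rho> < norm w}"
      and eq: "w * F (inverse w) = w' * F (inverse w')"
    then have "g (Some (of_real \<rho> * w)) = g (Some (of_real \<rho> * w'))" using gF by simp
    moreover have "Some (of_real \<rho> * w) \<in> exterior_disc 1" "Some (of_real \<rho> * w') \<in> exterior_disc 1"
      using w \<rho> by (auto simp: exterior_disc_def norm_mult field_simps)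
    ultimately have "of_real \<rho> * w = of_real \<rho> * w'" using inj_onD[OF inj] by blast
    then show "w = w'" using \<rho> by simp
  qed
  then have em: "exterior_map F \<rho>"
    using \<rho> holF F0(2) by unfold_locales (auto simp: F_def)
  moreover have "leading_coefficient (rescaled_map g e) = F 0"
  proof (rule leading_coefficient_eq[OF \<rho> holF])
    fix w :: complex assume "1 \<le> norm w"
    then have "inverse \<rho> < norm w" using \<rho> inverse_less_1_iff[of \<rho>] by linarith
    from gF[OF this] show "rescaled_map g e (Some w) = Some (w * F (inverse w))"
      by (simp add: rescaled_map_def \<rho>_def)
  qed
  ultimately show thesis
    using that[of F] gF by (simp add: \<rho>_def exterior_map.\<psi>_def)
qed

section \<open>Topology of the Riemann sphere\<close>

lemma topspace_sphere: "topspace riemann_sphere = UNIV"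
  by (auto simp: UNIV_option_conv)

(* The general rule would turn the universe into an explicit insertion of the point at infinity. *)
declare topspace_sphere [simp] topspace_Alexandroff_compactification [simp del]

lemma Hausdorff_sphere: "Hausdorff_space riemann_sphere"
  by (simp add: Hausdorff_space_Alexandroff_compactification locally_compact_space_euclidean)

text \<open>
Closed bounded plane sets are compact, so the neighbourhoods of infinity can be described by the discs around
infinity alone. All later openness proofs use this form.
\<close>

lemma openin_sphere_iff:
  "openin riemann_sphere U \<longleftrightarrow> open (Some -` U) \<and> (None \<in> U \<longrightarrow> (\<exists>r. exterior_disc r \<subseteq> U))"
proof
  assume U: "openin riemann_sphere U"
  then consider V where "open V" "U = Some ` V"
    | K where "compact K" "U = insert None (Some ` (- K))"
    by (auto simp: openin_Alexandroff_compactification Compl_eq_Diff_UNIV)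
  then show "open (Some -` U) \<and> (None \<in> U \<longrightarrow> (\<exists>r. exterior_disc r \<subseteq> U))"
  proof cases
    case 1
    then show ?thesis by (auto simp: inj_vimage_image_eq)
  next
    case 2
    obtain r where "\<And>z. z \<in> K \<Longrightarrow> norm z \<le> r" using 2(1) compact_imp_bounded bounded_iff by metis
    then have "exterior_disc r \<subseteq> U" using 2 by (force simp: exterior_disc_def)
    moreover have "Some -` U = - K" using 2 by auto
    ultimately show ?thesis using 2 by (auto simp: compact_imp_closed open_Compl)
  qed
next
  assume *: "open (Some -` U) \<and> (None \<in> U \<longrightarrow> (\<exists>r. exterior_disc r \<subseteq> U))"
  show "openin riemann_sphere U"
  proof (cases "None \<in> U")
    case False
    then have "U = Some ` (Some -` U)" by (auto simp: image_iff) (metis not_None_eq)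
    then show ?thesis using * by (metis openin_Alexandroff_compactification_image_Some open_openin)
  next
    case True
    then obtain r where r: "exterior_disc r \<subseteq> U" using * by blast
    define K where "K = - (Some -` U)"
    have "K \<subseteq> cball 0 r"
      using r by (force simp: K_def exterior_disc_def)
    moreover have "closed K" using * by (simp add: K_def closed_Compl)
    ultimately have "compact K" by (meson bounded_cball bounded_subset compact_eq_bounded_closed)
    moreover have "U = insert None (Some ` (UNIV - K))"
      using True by (auto simp: K_def image_iff)
    ultimately show ?thesis using \<open>closed K\<close>
      by (auto simp: openin_Alexandroff_compactification)
  qed
qed

lemma openin_sphere_image_Some: "open V \<Longrightarrow> openin riemann_sphere (Some ` V)"
  by simp

lemma openin_exterior_disc: "openin riemann_sphere (exterior_disc r)"
proof -
  have "Some -` exterior_disc r = {z. r < norm z}" by (auto simp: exterior_disc_def)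
  moreover have "open {z::complex. r < norm z}" by (intro open_Collect_less continuous_intros)
  ultimately show ?thesis by (auto simp: openin_sphere_iff)
qed

lemma connectedin_image_Some: "connected V \<Longrightarrow> connectedin riemann_sphere (Some ` V)"
  using connectedin_continuous_map_image[OF continuous_map_Some, of euclidean V] by simp

lemma connectedin_exterior_disc: "connectedin riemann_sphere (exterior_disc r)"
proof -
  have "connected {z::complex. r < norm z}"
  proof -
    have "{z::complex. r < norm z} = - cball 0 r" by auto
    then show ?thesis using connected_complement_bounded_convex[of "cball (0::complex) r"] by simp
  qed
  then have c: "connectedin riemann_sphere (Some ` {z. r < norm z})" by (rule connectedin_image_Some)
  have "exterior_disc r \<subseteq> riemann_sphere closure_of (Some ` {z. r < norm z})"
  proof -
    have "None \<in> riemann_sphere closure_of (Some ` {z. r < norm z})"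
      unfolding in_closure_of
    proof (intro conjI allI impI)
      fix T assume "None \<in> T \<and> openin riemann_sphere T"
      then obtain s where s: "exterior_disc s \<subseteq> T" by (auto simp: openin_sphere_iff)
      have "Some (of_real (\<bar>r\<bar> + \<bar>s\<bar> + 1)) \<in> exterior_disc s"
        unfolding exterior_disc_def by (auto simp: norm_of_real simp del: of_real_add)
      moreover have "Some (complex_of_real (\<bar>r\<bar> + \<bar>s\<bar> + 1)) \<in> Some ` {z. r < norm z}"
        by (auto simp: norm_of_real simp del: of_real_add)
      ultimately show "\<exists>y. y \<in> Some ` {z. r < cmod z} \<and> y \<in> T" using s by blast
    qed (simp add: topspace_sphere)
    then show ?thesis
      using closure_of_subset[of "Some ` {z. r < norm z}" riemann_sphere] by (auto simp: topspace_sphere exterior_disc_def)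
  qed
  then show ?thesis
    using connectedin_intermediate_closure_of[OF c, of "exterior_disc r"] by (auto simp: exterior_disc_def)
qed

lemma continuous_map_the: "continuous_map (subtopology riemann_sphere (range Some)) euclidean the"
proof -
  have "openin (subtopology riemann_sphere (range Some)) {x \<in> range Some. the x \<in> U}" if "open U" for U :: "complex set"
  proof -
    have "{x \<in> range Some. the x \<in> U} = Some ` U \<inter> range Some" by auto
    then show ?thesis using openin_sphere_image_Some[OF that] unfolding openin_subtopology by blast
  qed
  then show ?thesis by (auto simp: continuous_map_def topspace_sphere)
qed

lemma compactin_imp_closedin_sphere: "compactin riemann_sphere K \<Longrightarrow> closedin riemann_sphere K"
  by (rule compactin_imp_closedin[OF Hausdorff_sphere])

lemma closedin_imp_compactin_sphere: "closedin riemann_sphere K \<Longrightarrow> compactin riemann_sphere K"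
  by (rule closedin_compact_space) simp_all

lemma closedin_sphere_iff: "closedin riemann_sphere K \<longleftrightarrow> openin riemann_sphere (- K)"
  by (simp add: closedin_def topspace_sphere Compl_eq_Diff_UNIV)

section \<open>The two sides of a closed set\<close>

lemma outside_of_disjoint: "outside_of K \<inter> K = {}"
  unfolding outside_of_def
  using connected_component_of_subset_topspace[of "subtopology riemann_sphere (- K)" None] by auto

lemma connectedin_outside_of: "connectedin riemann_sphere (outside_of K)"
  unfolding outside_of_def
  using connectedin_connected_component_of[of "subtopology riemann_sphere (- K)" None]
  unfolding connectedin_subtopology by (rule conjunct1)

lemma None_in_outside_of: "None \<notin> K \<Longrightarrow> None \<in> outside_of K"
  by (simp add: outside_of_def connected_component_of_refl topspace_sphere)

lemma connected_subset_outside_of: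
  assumes "connectedin riemann_sphere C" "C \<inter> K = {}" "C \<inter> outside_of K \<noteq> {}"
  shows "C \<subseteq> outside_of K"
proof -
  obtain p where p: "p \<in> C" "p \<in> outside_of K" using assms by blast
  have C: "connectedin (subtopology riemann_sphere (- K)) C"
    using assms by (auto simp: connectedin_subtopology)
  have "C \<subseteq> connected_component_of_set (subtopology riemann_sphere (- K)) p"
    by (rule connected_component_of_maximal[OF C p(1)])
  moreover have "connected_component_of_set (subtopology riemann_sphere (- K)) p = outside_of K"
    using p(2) unfolding outside_of_def by (metis connected_component_of_equiv mem_Collect_eq)
  ultimately show ?thesis by simp
qed

lemma UNIV_inside_outside: "p \<in> K \<or> p \<in> inside_of K \<or> p \<in> outside_of K"
  by (auto simp: inside_of_def)

lemma inside_of_disjoint: "inside_of K \<inter> K = {}" "inside_of K \<inter> outside_of K = {}"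
  by (auto simp: inside_of_def)

lemma small_ball_avoiding:
  assumes "closedin riemann_sphere K" "Some z \<notin> K"
  obtains e where "e > 0" "Some ` ball z e \<inter> K = {}"
proof -
  have "open (Some -` (- K))" using assms by (simp add: closedin_sphere_iff openin_sphere_iff)
  moreover have "z \<in> Some -` (- K)" using assms by simp
  ultimately obtain e where "e > 0" "ball z e \<subseteq> Some -` (- K)" by (meson openE)
  then show thesis by (intro that[of e]) auto
qed

lemma exterior_subset_outside_of:
  assumes "A \<inter> exterior_disc r = {}" shows "exterior_disc r \<subseteq> outside_of A"
proof (rule connected_subset_outside_of[OF connectedin_exterior_disc])
  have "None \<in> exterior_disc r" by (simp add: exterior_disc_def)
  then show "exterior_disc r \<inter> outside_of A \<noteq> {}" using None_in_outside_of[of A] assms by blast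
qed (use assms in blast)

lemma open_inside_outside:
  assumes K: "closedin riemann_sphere K" and N: "None \<notin> K"
  shows "openin riemann_sphere (outside_of K)" "openin riemann_sphere (inside_of K)"
proof -
  obtain r where r: "exterior_disc r \<subseteq> - K"
    using K N by (auto simp: closedin_sphere_iff openin_sphere_iff)
  have ext: "exterior_disc r \<subseteq> outside_of K" using r by (intro exterior_subset_outside_of) auto
  have ball: "\<exists>e>0. Some ` ball z e \<inter> K = {} \<and> (Some ` ball z e \<subseteq> outside_of K \<or> Some ` ball z e \<inter> outside_of K = {})"
    if zK: "Some z \<notin> K" for z
  proof -
    obtain e where e: "e > 0" "Some ` ball z e \<inter> K = {}" by (rule small_ball_avoiding[OF K zK])
    then show ?thesis
      using connected_subset_outside_of[OF connectedin_image_Some e(2)] by (intro exI[of _ e]) auto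
  qed
  have "\<exists>e>0. ball z e \<subseteq> Some -` outside_of K" if z: "z \<in> Some -` outside_of K" for z
  proof -
    have "Some z \<notin> K" using outside_of_disjoint z by auto
    from ball[OF this] obtain e where e: "e > 0" "Some ` ball z e \<subseteq> outside_of K \<or> Some ` ball z e \<inter> outside_of K = {}"
      by blast
    moreover have "Some z \<in> Some ` ball z e" using e by auto
    ultimately show ?thesis using z by blast
  qed
  then have "open (Some -` outside_of K)" unfolding open_contains_ball by blast
  then show "openin riemann_sphere (outside_of K)" using ext by (auto simp: openin_sphere_iff)
  have "\<exists>e>0. ball z e \<subseteq> Some -` inside_of K" if z: "z \<in> Some -` inside_of K" for z
  proof -
    have z': "Some z \<notin> K" "Some z \<notin> outside_of K" using z by (auto simp: inside_of_def)
    from ball[OF z'(1)] obtain e where e: "e > 0" "Some ` ball z e \<inter> K = {}"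
      "Some ` ball z e \<subseteq> outside_of K \<or> Some ` ball z e \<inter> outside_of K = {}" by blast
    moreover have "Some z \<in> Some ` ball z e" using e by auto
    ultimately have "Some ` ball z e \<inter> outside_of K = {}" using z' by blast
    then show ?thesis using e unfolding inside_of_def by (intro exI[of _ e]) auto
  qed
  then have "open (Some -` inside_of K)" unfolding open_contains_ball by blast
  moreover have "None \<notin> inside_of K" using None_in_outside_of[OF N] by (auto simp: inside_of_def)
  ultimately show "openin riemann_sphere (inside_of K)" by (simp add: openin_sphere_iff)
qed

lemma annuliD:
  assumes "A \<in> annuli"
  shows "closedin riemann_sphere A" "None \<notin> A" "connectedin riemann_sphere (inside_of A)" "inside_of A \<noteq> {}"
    "\<exists>r>0. exterior_disc r \<subseteq> outside_of A"
proof -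
  show "closedin riemann_sphere A" using assms by (auto simp: annuli_def)
  obtain r where r: "r > 0" "A \<inter> exterior_disc r = {}" using assms by (auto simp: annuli_def)
  then show "None \<notin> A" by (auto simp: exterior_disc_def)
  show "\<exists>r>0. exterior_disc r \<subseteq> outside_of A" using r exterior_subset_outside_of by blast
  have td: "subtopology riemann_sphere (inside_of A) homeomorphic_space top_of_set (ball (0::complex) 1)"
    using assms by (auto simp: annuli_def topological_disc_def)
  have "connected_space (top_of_set (ball (0::complex) 1))" by (simp add: connected_space_subtopology)
  then have "connected_space (subtopology riemann_sphere (inside_of A))"
    using homeomorphic_connected_space[OF td] by blast
  then show "connectedin riemann_sphere (inside_of A)" by (simp add: connectedin_def topspace_sphere)
  show "inside_of A \<noteq> {}"
    using homeomorphic_empty_space[OF td] null_topspace_iff_trivial[of "top_of_set (ball (0::complex) 1)"]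
    by auto
qed

text \<open>
Each inside is connected and avoids the other set, so if the claim failed, the two insides would coincide. A boundary
point of the common inside would then lie in both of the disjoint sets \<open>A\<close> and \<open>B\<close>.
\<close>

lemma inside_subset_outside:
  assumes A: "A \<in> annuli" and B: "B \<in> annuli"
    and disj: "A \<inter> B = {}" "A \<inter> inside_of B = {}" "B \<inter> inside_of A = {}"
  shows "inside_of A \<subseteq> outside_of B"
proof (rule ccontr)
  note oA = open_inside_outside[OF annuliD(1,2)[OF A]] and oB = open_inside_outside[OF annuliD(1,2)[OF B]]
  assume nsub: "\<not> inside_of A \<subseteq> outside_of B"
  have meets: "inside_of A \<inter> outside_of B = {}"
    using connected_subset_outside_of[OF annuliD(3)[OF A], of B] disj nsub by blast
  then have AB: "inside_of A \<subseteq> inside_of B" using disj by (auto simp: inside_of_def)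
  have "inside_of B \<inter> outside_of A = {}"
    using connected_subset_outside_of[OF annuliD(3)[OF B], of A] disj AB annuliD(4)[OF A]
      inside_of_disjoint(2)[of A] by blast
  then have BA: "inside_of B \<subseteq> inside_of A" using disj by (auto simp: inside_of_def)
  have eq: "inside_of A = inside_of B" using AB BA by blast
  let ?U = "Some -` inside_of A"
  have op: "open ?U" using oA by (simp add: openin_sphere_iff)
  have "inside_of A \<inter> {None} = {}" using None_in_outside_of[OF annuliD(2)[OF A]] by (auto simp: inside_of_def)
  moreover obtain p where "p \<in> inside_of A" using annuliD(4)[OF A] by blast
  ultimately have ne: "?U \<noteq> {}" by (cases p) auto
  obtain r where r: "exterior_disc r \<subseteq> outside_of A" using annuliD(5)[OF A] by blast
  have "?U \<subseteq> cball 0 r"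
    using r inside_of_disjoint(2)[of A] by (force simp: exterior_disc_def)
  then have "?U \<noteq> UNIV" using not_bounded_UNIV bounded_cball bounded_subset by metis
  then have "\<not> closed ?U" using clopen[of ?U] op ne by blast
  then obtain z where z: "z \<in> closure ?U" "z \<notin> ?U" by (metis closure_subset closure_eq subsetI subset_antisym)
  have "Some z \<in> X" if X: "X \<in> annuli" "inside_of X = inside_of A" for X
  proof -
    have "Some z \<notin> outside_of X"
    proof
      assume "Some z \<in> outside_of X"
      moreover have "open (Some -` outside_of X)"
        using open_inside_outside(1)[OF annuliD(1,2)[OF X(1)]] by (simp add: openin_sphere_iff)
      ultimately have "Some -` outside_of X \<inter> ?U \<noteq> {}"
        using z(1) open_Int_closure_eq_empty by blast
      then show False using inside_of_disjoint(2)[of X] X(2) by auto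
    qed
    then show ?thesis using UNIV_inside_outside[of "Some z" X] z(2) X(2) by auto
  qed
  from this[OF A] this[OF B] eq disj(1) show False by auto
qed

section \<open>The curve separates the sides of its annulus\<close>

text \<open>
The loop that runs once around \<open>C\<close> is null-homotopic in \<open>W\<close>. If it were null-homotopic in \<open>C\<close> itself, then, as
\<open>C\<close> is a circle, the standard loop around the circle would be null-homotopic in the circle, contradicting its winding number \<open>1\<close>.
\<close>

lemma not_pi1_injects_if_in_simply_connected:
  assumes jc: "jordan_curve C" and CW: "C \<subseteq> Some ` W" and WA: "Some ` W \<subseteq> A" and sc: "simply_connected W"
  shows "\<not> pi1_injects C A"
proof
  assume pi1: "pi1_injects C A"
  let ?S = "riemann_sphere"
  obtain k h where hk: "homeomorphic_maps (subtopology ?S C) (top_of_set (sphere (0::complex) 1)) k h"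
    using jc unfolding jordan_curve_def homeomorphic_space_def by blast
  have h: "continuous_map (top_of_set (sphere 0 1)) (subtopology ?S C) h"
    and k: "continuous_map (subtopology ?S C) (top_of_set (sphere 0 1)) k"
    and kh: "\<And>y. y \<in> sphere 0 1 \<Longrightarrow> k (h y) = y"
    using hk by (auto simp: homeomorphic_maps_def)
  have hC: "h y \<in> C" if "y \<in> sphere 0 1" for y
    using continuous_map_image_subset_topspace[OF h] that by auto
  define c where "c = circlepath (0::complex) 1"
  have c_sphere: "c x \<in> sphere 0 1" for x
  proof -
    have "c x = exp (\<i> * of_real (2 * pi * x))" by (simp add: c_def circlepath field_simps)
    then have "norm (c x) = 1" by (metis norm_exp_i_times)
    then show ?thesis by simp
  qed
  have c_map: "continuous_map (top_of_set {0..1}) (top_of_set (sphere 0 1)) c"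
    using path_circlepath[of 0 1] c_sphere unfolding path_def c_def[symmetric]
    by (auto simp: continuous_map_in_subtopology)
  define p where "p = h \<circ> c"
  define q where "q = (\<lambda>x::real. h 1)"
  have p_map: "continuous_map (top_of_set {0..1}) (subtopology ?S C) p"
    unfolding p_def using c_map h by (rule continuous_map_compose)
  have pC: "p x \<in> C" for x unfolding p_def using hC c_sphere by simp
  have c01: "c 0 = 1" "c 1 = 1" by (auto simp: c_def circlepath)
  define p' where "p' = the \<circ> p"
  have p': "p x = Some (p' x)" "p' x \<in> W" for x using pC[of x] CW by (auto simp: p'_def)
  have "continuous_map (top_of_set {0..1}) (subtopology ?S (range Some)) p"
    using p_map p' by (auto simp: continuous_map_in_subtopology)
  then have "continuous_map (top_of_set {0..1}) euclidean p'"
    unfolding p'_def using continuous_map_the by (rule continuous_map_compose)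
  then have path_p': "path p'" by (simp add: path_def)
  have loop: "pathfinish p' = pathstart p'"
    using p'(1)[of 0] p'(1)[of 1] c01 by (simp add: pathstart_def pathfinish_def p_def)
  have "homotopic_paths W p' (linepath (pathstart p') (pathstart p'))"
    using sc path_p' loop p' unfolding simply_connected_eq_contractible_path
    by (auto simp: path_image_def)
  then have "homotopic_with (\<lambda>r. pathstart r = pathstart p' \<and> pathfinish r = pathfinish p')
      (top_of_set {0..1}) (top_of_set W) p' (linepath (pathstart p') (pathstart p'))"
    by (simp add: homotopic_paths_def)
  moreover have "continuous_map (top_of_set W) (subtopology ?S A) Some"
    using continuous_map_from_subtopology[OF continuous_map_Some, of euclidean W] WA
    by (auto simp: continuous_map_in_subtopology)
  ultimately have "homotopic_with (\<lambda>r. r 0 = p 0 \<and> r 1 = p 1) (top_of_set {0..1}) (subtopology ?S A)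
      (Some \<circ> p') (Some \<circ> linepath (pathstart p') (pathstart p'))"
    by (rule homotopic_with_compose_continuous_map_left) (auto simp: pathstart_def pathfinish_def p')
  moreover have "Some \<circ> p' = p" using p' by auto
  moreover have "Some \<circ> linepath (pathstart p') (pathstart p') = q"
    using p'(1)[of 0] c01 by (auto simp: q_def linepath_def pathstart_def p_def fun_eq_iff algebra_simps)
  ultimately have "sphere_homotopic_paths A p q" by (simp add: sphere_homotopic_paths_def)
  moreover have "pathin (subtopology ?S C) p" using p_map by (simp add: pathin_def)
  moreover have "pathin (subtopology ?S C) q" using hC[of 1] by (simp add: q_def)
  moreover have "p 0 = p 1" "q 0 = q 1" "p 0 = q 0" using c01 by (auto simp: p_def q_def)
  ultimately have "sphere_homotopic_paths C p q" using pi1 unfolding pi1_injects_def by blast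
  then have "homotopic_with (\<lambda>r. r 0 = p 0 \<and> r 1 = p 1) (top_of_set {0..1}) (subtopology ?S C) p q"
    by (simp add: sphere_homotopic_paths_def)
  from homotopic_with_compose_continuous_map_left[OF this k,
      of "\<lambda>r. pathstart r = pathstart c \<and> pathfinish r = pathfinish c"]
  have "homotopic_paths (sphere 0 1) (k \<circ> p) (k \<circ> q)"
    using kh c01 by (simp add: homotopic_paths_def pathstart_def pathfinish_def p_def)
  moreover have "k \<circ> p = c" using kh c_sphere by (auto simp: p_def fun_eq_iff)
  moreover have "k \<circ> q = linepath 1 1" using kh[of 1] by (auto simp: q_def linepath_def fun_eq_iff algebra_simps)
  ultimately have "homotopic_paths (sphere 0 1) c (linepath 1 1)" by simp
  then have "homotopic_paths (- {0}) c (linepath 1 1)" by (rule homotopic_paths_subset) auto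
  then have "winding_number c 0 = winding_number (linepath 1 1) 0" by (rule winding_number_homotopic_paths)
  then show False using winding_number_circlepath_centre[of 1 0] by (simp add: c_def winding_number_trivial)
qed

lemma jordan_curve_compactin: "jordan_curve C \<Longrightarrow> compactin riemann_sphere C"
proof -
  assume "jordan_curve C"
  then have "compact_space (subtopology riemann_sphere C) \<longleftrightarrow> compact_space (top_of_set (sphere (0::complex) 1))"
    unfolding jordan_curve_def by (rule homeomorphic_compact_space)
  moreover have "compact_space (top_of_set (sphere (0::complex) 1))"
    by (intro compact_space_subtopology) simp
  ultimately show ?thesis by (simp add: compactin_subspace)
qed

lemma jordan_curve_connectedin: "jordan_curve C \<Longrightarrow> connectedin riemann_sphere C"
proof -
  assume "jordan_curve C"
  then have "connected_space (subtopology riemann_sphere C) \<longleftrightarrow> connected_space (top_of_set (sphere (0::complex) 1))"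
    unfolding jordan_curve_def by (rule homeomorphic_connected_space)
  moreover have "connectedin euclidean (sphere (0::complex) 1)" using connected_sphere[of "0::complex" 1] by simp
  then have "connected_space (top_of_set (sphere (0::complex) 1))" unfolding connectedin_def by (rule conjunct2)
  ultimately show ?thesis by (simp add: connectedin_def)
qed

lemma conformal_iso_continuous:
  assumes "conformal_iso g S T"
  shows "continuous_map (subtopology riemann_sphere S) riemann_sphere g"
    "continuous_map (subtopology riemann_sphere T) riemann_sphere (inv_into S g)"
    "bij_betw g S T"
proof -
  have "bij_betw g S T \<and> continuous_map (subtopology riemann_sphere S) riemann_sphere g
    \<and> continuous_map (subtopology riemann_sphere T) riemann_sphere (inv_into S g)"
    using assms unfolding conformal_iso_def sphere_holomorphic_on_def by (elim conjE) (intro conjI)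
  then show "continuous_map (subtopology riemann_sphere S) riemann_sphere g"
    "continuous_map (subtopology riemann_sphere T) riemann_sphere (inv_into S g)" "bij_betw g S T" by simp_all
qed

lemma closedin_outside_disc: "closedin riemann_sphere (insert None (Some ` {z::complex. r \<le> norm z}))"
proof -
  have "- insert None (Some ` {z::complex. r \<le> norm z}) = Some ` ball 0 r"
  proof (rule set_eqI)
    fix p show "p \<in> - insert None (Some ` {z::complex. r \<le> norm z}) \<longleftrightarrow> p \<in> Some ` ball 0 r"
      by (cases p) (auto simp: image_iff)
  qed
  then show ?thesis using openin_sphere_image_Some[of "ball 0 r"] by (simp add: closedin_sphere_iff)
qed

text \<open>
Otherwise both sides of \<open>A\<close> lie outside \<open>C\<close>, so \<open>C\<close> and everything inside it lie in the interior of \<open>A\<close>. By compactness the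
image under \<open>g\<close> of a slightly smaller exterior disc \<open>{\<bar>z\<bar> \<ge> 1 + \<delta>}\<close> still covers the complement of that
interior. The complement \<open>W\<close> of this image is an open neighbourhood of \<open>C\<close> in \<open>A\<close>, and the component of
\<open>W\<close> that contains \<open>C\<close> is simply connected because its complement is connected.
\<close>

lemma essential_curve_separates:
  assumes A: "A \<in> annuli" and ess: "essential_curve A C"
    and ci: "conformal_iso g (exterior_disc 1) (outside_of C)" and gN: "g None = None"
  shows "inside_of A \<inter> outside_of C = {}"
proof (rule ccontr)
  assume meets: "inside_of A \<inter> outside_of C \<noteq> {}"
  let ?S = "riemann_sphere"
  let ?E1 = "exterior_disc 1"
  have jc: "jordan_curve C" and Cint: "C \<subseteq> ?S interior_of A" and pi1: "pi1_injects C A"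
    using ess unfolding essential_curve_def by simp_all
  have CA: "C \<subseteq> A" using Cint interior_of_subset[of ?S A] by (rule subset_trans)
  have cC: "closedin ?S C" and NC: "None \<notin> C"
    using jordan_curve_compactin[OF jc] compactin_imp_closedin_sphere annuliD(2)[OF A] CA by auto
  have "inside_of A \<subseteq> outside_of C"
    using connected_subset_outside_of[OF annuliD(3)[OF A] _ meets] inside_of_disjoint(1)[of A] CA by blast
  moreover have "outside_of A \<subseteq> outside_of C"
  proof (rule connected_subset_outside_of[OF connectedin_outside_of])
    show "outside_of A \<inter> C = {}" using outside_of_disjoint CA by blast
    show "outside_of A \<inter> outside_of C \<noteq> {}"
      using None_in_outside_of[OF NC] None_in_outside_of[OF annuliD(2)[OF A]] by blast
  qed
  ultimately have compl: "- outside_of C \<subseteq> A" using UNIV_inside_outside[of _ A] by blast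
  have "inside_of C \<subseteq> ?S interior_of A"
    using open_inside_outside(2)[OF cC NC] compl by (intro interior_of_maximal) (auto simp: inside_of_def)
  then have sub: "- outside_of C \<subseteq> ?S interior_of A" using Cint by (auto simp: inside_of_def)
  define Z where "Z = - (?S interior_of A)"
  have ZT: "Z \<subseteq> outside_of C" using sub by (auto simp: Z_def)
  have "closedin ?S Z" by (simp add: Z_def closedin_sphere_iff)
  then have Zc: "compactin (subtopology ?S (outside_of C)) Z"
    using closedin_imp_compactin_sphere ZT by (simp add: compactin_subtopology)
  have g: "continuous_map (subtopology ?S ?E1) ?S g"
    and gi: "continuous_map (subtopology ?S (outside_of C)) ?S (inv_into ?E1 g)"
    and bij: "bij_betw g ?E1 (outside_of C)"
    using conformal_iso_continuous[OF ci] by auto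
  define Q where "Q = inv_into ?E1 g ` Z"
  have QE1: "Q \<subseteq> ?E1" using bij_betw_inv_into[OF bij] ZT by (auto simp: Q_def bij_betw_def)
  have "compactin ?S Q" unfolding Q_def by (rule image_compactin[OF Zc gi])
  then have "openin ?S (- Q)" using compactin_imp_closedin_sphere by (simp add: closedin_sphere_iff)
  then have "open (Some -` (- Q))" by (simp add: openin_sphere_iff)
  moreover have "cball 0 1 \<subseteq> Some -` (- Q)" using QE1 by (force simp: exterior_disc_def)
  ultimately obtain \<delta> where \<delta>: "\<delta> > 0" "(\<Union>x\<in>cball 0 1. cball x \<delta>) \<subseteq> Some -` (- Q)"
    using compact_subset_open_imp_cball_epsilon_subset[OF compact_cball] by metis
  have Q\<delta>: "1 + \<delta> \<le> norm z" if "Some z \<in> Q" for z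
  proof (rule ccontr)
    assume "\<not> 1 + \<delta> \<le> norm z"
    then have n: "norm z < 1 + \<delta>" by simp
    have "1 < norm z" using QE1 that by (auto simp: exterior_disc_def)
    define x where "x = z / of_real (norm z)"
    have "x \<in> cball 0 1" using \<open>1 < norm z\<close> by (simp add: x_def norm_divide)
    moreover have "dist x z \<le> \<delta>"
    proof -
      have zx: "of_real (norm z) * x = z" using \<open>1 < norm z\<close> by (auto simp: x_def)
      have "of_real (1 - norm z) * x = x - of_real (norm z) * x" by (simp add: left_diff_distrib)
      then have "x - z = of_real (1 - norm z) * x" unfolding zx by simp
      then have "dist x z = \<bar>1 - norm z\<bar> * norm x" by (simp only: dist_norm norm_mult norm_of_real)
      also have "norm x = 1" using \<open>1 < norm z\<close> by (auto simp: x_def norm_divide)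
      finally show ?thesis using n \<open>1 < norm z\<close> by simp
    qed
    ultimately have "z \<in> (\<Union>x\<in>cball 0 1. cball x \<delta>)" by (intro UN_I[of x]) auto
    then have "z \<in> Some -` (- Q)" using \<delta>(2) by blast
    then show False using that by simp
  qed
  (* The exterior disc is shrunk to a closed one, so that its image is compact and W open. *)
  define L where "L = insert None (Some ` {z::complex. 1 + \<delta> \<le> norm z})"
  have LE1: "L \<subseteq> ?E1" using \<delta> by (auto simp: L_def exterior_disc_def)
  have "compactin (subtopology ?S ?E1) L"
    using closedin_imp_compactin_sphere[OF closedin_outside_disc] LE1 by (simp add: L_def compactin_subtopology)
  then have "compactin ?S (g ` L)" by (rule image_compactin[OF _ g])
  then have "openin ?S (- (g ` L))" using compactin_imp_closedin_sphere by (simp add: closedin_sphere_iff)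
  then have openW: "open (Some -` (- (g ` L)))" by (simp add: openin_sphere_iff)
  define W where "W = Some -` (- (g ` L))"
  have gLT: "g ` L \<subseteq> outside_of C" using LE1 bij by (auto simp: bij_betw_def)
  have ZgL: "Z \<subseteq> g ` L"
  proof
    fix z assume "z \<in> Z"
    then have inQ: "inv_into ?E1 g z \<in> Q" by (simp add: Q_def)
    have "inv_into ?E1 g z \<in> L"
    proof (cases "inv_into ?E1 g z")
      case (Some w)
      then have "1 + \<delta> \<le> norm w" using Q\<delta> inQ by simp
      then show ?thesis using Some by (simp add: L_def)
    qed (simp add: L_def)
    moreover have "g (inv_into ?E1 g z) = z" using bij_betw_inv_into_right[OF bij] \<open>z \<in> Z\<close> ZT by blast
    ultimately show "z \<in> g ` L" by force
  qed
  have WA: "Some ` W \<subseteq> A"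
    using ZgL interior_of_subset[of ?S A] by (auto simp: W_def Z_def)
  have CW: "C \<subseteq> Some ` W"
  proof
    fix x assume x: "x \<in> C"
    then obtain z where "x = Some z" using NC by (cases x) auto
    then show "x \<in> Some ` W" using x gLT outside_of_disjoint[of C] by (auto simp: W_def)
  qed
  have "connected (- W)"
  proof -
    obtain F where F: "F holomorphic_on ball 0 1" "\<And>z. 1 < norm z \<Longrightarrow> g (Some z) = Some (z * F (inverse z))"
      by (rule conformal_iso_at_infinity[OF ci gN]) blast
    have eq: "- W = (\<lambda>z. z * F (inverse z)) ` (- ball 0 (1 + \<delta>))"
    proof -
      have "- W = {z. Some z \<in> g ` L}" by (auto simp: W_def)
      also have "\<dots> = (\<lambda>z. z * F (inverse z)) ` {z. 1 + \<delta> \<le> norm z}"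
      proof (rule set_eqI)
        fix z
        have "z \<in> {z. Some z \<in> g ` L} \<longleftrightarrow> (\<exists>w. 1 + \<delta> \<le> norm w \<and> g (Some w) = Some z)"
          using gN unfolding L_def image_insert image_image by (auto simp: image_iff)
        also have "\<dots> \<longleftrightarrow> (\<exists>w. 1 + \<delta> \<le> norm w \<and> Some (w * F (inverse w)) = Some z)"
        proof (intro ex_cong1 conj_cong refl)
          fix w :: complex assume "1 + \<delta> \<le> norm w"
          then have "g (Some w) = Some (w * F (inverse w))" using F(2) \<delta>(1) by simp
          then show "(g (Some w) = Some z) = (Some (w * F (inverse w)) = Some z)" by simp
        qed
        also have "\<dots> \<longleftrightarrow> z \<in> (\<lambda>z. z * F (inverse z)) ` {z. 1 + \<delta> \<le> norm z}" by auto
        finally show "z \<in> {z. Some z \<in> g ` L} \<longleftrightarrow> z \<in> (\<lambda>z. z * F (inverse z)) ` {z. 1 + \<delta> \<le> norm z}" .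
      qed
      also have "{z::complex. 1 + \<delta> \<le> norm z} = - ball 0 (1 + \<delta>)" by auto
      finally show ?thesis .
    qed
    have "(F \<circ> inverse) holomorphic_on (- ball 0 (1 + \<delta>))"
      by (rule holomorphic_on_compose_gen[OF _ F(1)])
        (use \<delta> in \<open>auto intro!: holomorphic_intros simp: norm_inverse inverse_less_1_iff\<close>)
    then have "(\<lambda>z. z * F (inverse z)) holomorphic_on (- ball 0 (1 + \<delta>))"
      by (auto intro!: holomorphic_intros simp: o_def)
    moreover have "connected (- ball (0::complex) (1 + \<delta>))"
      by (rule connected_complement_bounded_convex) auto
    ultimately show ?thesis unfolding eq
      by (intro connected_continuous_image holomorphic_on_imp_continuous_on)
  qed
  define C' where "C' = the ` C"
  have CC': "C = Some ` C'"
  proof -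
    have "Some (the p) = p" if "p \<in> C" for p using that NC by (cases p) auto
    then show ?thesis by (simp add: C'_def image_image)
  qed
  have conC': "connected C'"
  proof -
    have "connectedin (subtopology ?S (range Some)) C"
      using jordan_curve_connectedin[OF jc] CC' by (auto simp: connectedin_subtopology)
    from connectedin_continuous_map_image[OF continuous_map_the this] show ?thesis by (simp add: C'_def)
  qed
  have "C \<noteq> {}"
  proof
    assume "C = {}"
    then have "top_of_set (sphere (0::complex) 1) = trivial_topology"
      using jc homeomorphic_empty_space unfolding jordan_curve_def by force
    then have "sphere (0::complex) 1 = {}"
      by (metis null_topspace_iff_trivial topspace_euclidean_subtopology)
    moreover have "(1::complex) \<in> sphere 0 1" by simp
    ultimately show False by blast
  qed
  then obtain x0 where x0: "x0 \<in> C'" using CC' by blast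
  define W0 where "W0 = connected_component_set W x0"
  have C'W: "C' \<subseteq> W" using CW CC' by auto
  have C'W0: "C' \<subseteq> W0" unfolding W0_def using x0 conC' C'W by (rule connected_component_maximal)
  have W0: "W0 \<in> components W" using x0 C'W by (auto simp: W0_def componentsI)
  have "bounded W"
  proof -
    obtain r where r: "exterior_disc r \<subseteq> outside_of A" using annuliD(5)[OF A] by blast
    have "W \<subseteq> cball 0 r"
    proof
      fix z assume "z \<in> W"
      then have "Some z \<in> A" using WA by blast
      then have "Some z \<notin> exterior_disc r" using r outside_of_disjoint[of A] by blast
      then show "z \<in> cball 0 r" by (auto simp: exterior_disc_def)
    qed
    then show ?thesis by (rule bounded_subset[OF bounded_cball])
  qed
  then have "bounded W0" using in_components_subset[OF W0] by (rule bounded_subset)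
  moreover have "open W0" using open_components[OF _ W0] openW unfolding W_def by simp
  moreover have "connected W0" by (rule in_components_connected[OF W0])
  moreover have "connected (- W0)"
    using component_complement_connected[OF \<open>connected (- W)\<close>, of W0] W0 by simp
  ultimately have "simply_connected W0" using simply_connected_iff_simple[of W0] by simp
  moreover have "Some ` W0 \<subseteq> A" using WA in_components_subset[OF W0] by blast
  moreover have "C \<subseteq> Some ` W0" using C'W0 CC' by auto
  ultimately show False using not_pi1_injects_if_in_simply_connected[OF jc] pi1 by blast
qed

section \<open>Uniform behaviour of the node polynomials on the sides of an annulus\<close>

text \<open>
The preimage of the unbounded side under \<open>g\<close> is connected and contains infinity. By compactness
it misses not only the circle of radius \<open>1 + e\<close> but a closed annulus around it, so it lies beyond that annulus. The
gap \<open>\<delta>\<close> is what makes the growth in the next lemma uniform.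
\<close>

lemma outside_of_in_exterior:
  assumes A: "A \<in> annuli" and ac: "admissible_choice A C g e"
  obtains \<delta> where "\<delta> > 0"
    "outside_of A \<subseteq> g ` insert None (Some ` {z. 1 + e + \<delta> \<le> norm z})"
proof -
  let ?S = "riemann_sphere" and ?E1 = "exterior_disc 1"
  have ess: "essential_curve A C" and ci: "conformal_iso g ?E1 (outside_of C)" and gN: "g None = None"
    and e: "e > 0" and circ: "g ` Some ` {z. norm z = 1 + e} \<subseteq> ?S interior_of A"
    using ac unfolding admissible_choice_def by simp_all
  note gc = conformal_iso_continuous[OF ci]
  have Cint: "C \<subseteq> ?S interior_of A" using ess by (simp add: essential_curve_def)
  then have CA: "C \<subseteq> A" using interior_of_subset[of ?S A] by (rule subset_trans)
  have NC: "None \<notin> C" using CA annuliD(2)[OF A] by blast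
  have AC: "outside_of A \<subseteq> outside_of C"
  proof (rule connected_subset_outside_of[OF connectedin_outside_of])
    show "outside_of A \<inter> C = {}" using outside_of_disjoint[of A] CA by blast
    show "outside_of A \<inter> outside_of C \<noteq> {}"
      using None_in_outside_of[OF NC] None_in_outside_of[OF annuliD(2)[OF A]] by blast
  qed
  define V where "V = Some -` {p \<in> ?E1. g p \<in> ?S interior_of A}"
  have "openin (subtopology ?S ?E1) {p \<in> topspace (subtopology ?S ?E1). g p \<in> ?S interior_of A}"
    using gc(1) openin_interior_of by (rule openin_continuous_map_preimage)
  then have "openin ?S {p \<in> ?E1. g p \<in> ?S interior_of A}"
    using openin_trans_full[OF _ openin_exterior_disc] by simp
  then have openV: "open V" by (simp add: V_def openin_sphere_iff)
  have "sphere 0 (1 + e) \<subseteq> V"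
    using circ e unfolding V_def by (auto simp: exterior_disc_def)
  from compact_subset_open_imp_cball_epsilon_subset[OF compact_sphere openV this]
  obtain \<delta> where \<delta>: "\<delta> > 0" and \<delta>V: "(\<Union>x\<in>sphere 0 (1 + e). cball x \<delta>) \<subseteq> V" .
  have ann: "z \<in> V" if z: "1 + e \<le> norm z" "norm z \<le> 1 + e + \<delta>" for z
  proof -
    define x where "x = of_real ((1 + e) / norm z) * z"
    have z0: "norm z > 0" using z e by linarith
    have "norm x = 1 + e" using z0 e unfolding x_def norm_mult norm_of_real by simp
    then have xs: "x \<in> sphere 0 (1 + e)" by simp
    have "x - z = of_real ((1 + e) / norm z - 1) * z" by (simp add: x_def left_diff_distrib)
    then have "dist x z = \<bar>(1 + e) / norm z - 1\<bar> * norm z" by (simp only: dist_norm norm_mult norm_of_real)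
    also have "\<dots> = norm z - (1 + e)" using z z0 e by (simp add: abs_if field_simps)
    also have "\<dots> \<le> \<delta>" using z by simp
    finally have "z \<in> cball x \<delta>" by simp
    then show ?thesis using xs \<delta>V by blast
  qed
  define Q where "Q = inv_into ?E1 g ` outside_of A"
  have "connectedin (subtopology ?S (outside_of C)) (outside_of A)"
    using connectedin_outside_of AC by (simp add: connectedin_subtopology)
  from connectedin_continuous_map_image[OF gc(2) this]
  have conQ: "connectedin ?S Q" by (simp add: Q_def)
  have gQ: "g p \<in> outside_of A" "p \<in> ?E1" if "p \<in> Q" for p
  proof -
    obtain y where y: "y \<in> outside_of A" "p = inv_into ?E1 g y" using \<open>p \<in> Q\<close> by (auto simp: Q_def)
    then show "g p \<in> outside_of A" using bij_betw_inv_into_right[OF gc(3)] AC by auto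
    show "p \<in> ?E1" using y bij_betw_inv_into[OF gc(3)] AC by (auto simp: bij_betw_def)
  qed
  have "None \<in> Q"
  proof -
    have "inv_into ?E1 g None = None"
      using inv_into_f_f[of g ?E1 None] gc(3) gN by (simp add: bij_betw_def exterior_disc_def)
    then show ?thesis using None_in_outside_of[OF annuliD(2)[OF A]] unfolding Q_def by force
  qed
  have notV: "Some z \<notin> Q" if "z \<in> V" for z
  proof
    assume "Some z \<in> Q"
    then have "g (Some z) \<in> outside_of A" using gQ by blast
    moreover have "g (Some z) \<in> A" using that interior_of_subset[of ?S A] by (auto simp: V_def)
    ultimately show False using outside_of_disjoint[of A] by blast
  qed
  have Qsub: "Q \<subseteq> exterior_disc (1 + e) \<union> Some ` ball 0 (1 + e)"
  proof
    fix p assume p: "p \<in> Q"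
    show "p \<in> exterior_disc (1 + e) \<union> Some ` ball 0 (1 + e)"
    proof (cases p)
      case (Some z)
      then have "norm z \<noteq> 1 + e" using ann[of z] \<delta> notV[of z] p by auto
      then have "1 + e < norm z \<or> norm z < 1 + e" by linarith
      then show ?thesis using Some by (auto simp: exterior_disc_def)
    qed (simp add: exterior_disc_def)
  qed
  have "Q \<inter> Some ` ball 0 (1 + e) = {}"
  proof (rule ccontr)
    assume "Q \<inter> Some ` ball 0 (1 + e) \<noteq> {}"
    moreover have "None \<in> exterior_disc (1 + e)" by (simp add: exterior_disc_def)
    then have "exterior_disc (1 + e) \<inter> Q \<noteq> {}" using \<open>None \<in> Q\<close> by blast
    moreover have "exterior_disc (1 + e) \<inter> Some ` ball 0 (1 + e) \<inter> Q = {}" by (auto simp: exterior_disc_def)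
    ultimately show False
      using conQ Qsub openin_exterior_disc[of "1 + e"] openin_sphere_image_Some[of "ball 0 (1 + e)"]
      unfolding connectedin by (metis Int_commute open_ball)
  qed
  have "outside_of A \<subseteq> g ` insert None (Some ` {z. 1 + e + \<delta> \<le> norm z})"
  proof
    fix y assume y: "y \<in> outside_of A"
    define p where "p = inv_into ?E1 g y"
    have pQ: "p \<in> Q" using y by (simp add: p_def Q_def)
    have gp: "g p = y" unfolding p_def using bij_betw_inv_into_right[OF gc(3)] AC y by blast
    have "p \<in> insert None (Some ` {z. 1 + e + \<delta> \<le> norm z})"
    proof (cases p)
      case (Some z)
      have "Some z \<notin> Some ` ball 0 (1 + e)" using \<open>Q \<inter> Some ` ball 0 (1 + e) = {}\<close> pQ Some by blast
      then have "1 + e \<le> norm z" by auto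
      then have "1 + e + \<delta> \<le> norm z" using ann[of z] notV[of z] pQ Some by fastforce
      then show ?thesis using Some by simp
    qed simp
    then show "y \<in> g ` insert None (Some ` {z. 1 + e + \<delta> \<le> norm z})" using gp by blast
  qed
  with \<delta> show thesis by (rule that)
qed

text \<open>
The circle of radius \<open>1 + \<epsilon>\<close> carries the nodes, so \<open>1/(1 + \<epsilon>)\<close> in the rescaled coordinate corresponds to
the curve \<open>C\<close> itself: points inside \<open>A\<close> are not attained there, and points outside \<open>A\<close> are attained at a
parameter of modulus at least \<open>1 + \<delta>/(1 + \<epsilon>)\<close>.
\<close>

lemma omega_asymptotics:
  assumes A: "A \<in> annuli" and ac: "admissible_choice A C (\<phi> A) (\<epsilon> A)" and \<eta>: "0 < \<eta>"
  shows "\<exists>N\<ge>1. \<forall>n\<ge>N.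
    (\<forall>z. Some z \<in> inside_of A \<longrightarrow> norm (poly (omega \<phi> \<epsilon> A n) z + 1) < \<eta>) \<and>
    (\<forall>z. Some z \<in> outside_of A \<longrightarrow> M \<le> norm (poly (omega \<phi> \<epsilon> A n) z))"
proof -
  let ?g = "\<phi> A" and ?e = "\<epsilon> A"
  have ess: "essential_curve A C" and ci: "conformal_iso ?g (exterior_disc 1) (outside_of C)"
    and gN: "?g None = None" and e: "?e > 0"
    using ac unfolding admissible_choice_def by simp_all
  obtain F where F: "exterior_map F (1 + ?e)"
    "\<And>w. inverse (1 + ?e) < norm w \<Longrightarrow> ?g (Some (of_real (1 + ?e) * w)) = Some (exterior_map.\<psi> F w)"
    "leading_coefficient (rescaled_map ?g ?e) = F 0"
    by (rule rescaled_map_expansion[OF ci gN e]) blast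
  interpret exterior_map F "1 + ?e" by (rule F(1))
  have poly_omega: "poly (omega \<phi> \<epsilon> A n) z = W n z" for n z
  proof -
    have "node \<phi> \<epsilon> A n k = \<psi> (nth_root n k)" for k
    proof -
      have "inverse (1 + ?e) < norm (nth_root n k)" using e by (simp add: inverse_less_1_iff)
      from F(2)[OF this] show ?thesis by (simp add: node_def rescaled_map_def)
    qed
    then show ?thesis by (simp add: omega_def W_def F(3) poly_prod)
  qed
  obtain \<delta> where \<delta>: "\<delta> > 0" "outside_of A \<subseteq> ?g ` insert None (Some ` {z. 1 + ?e + \<delta> \<le> norm z})"
    by (rule outside_of_in_exterior[OF A ac])
  obtain r where r: "exterior_disc r \<subseteq> outside_of A" using annuliD(5)[OF A] by blast
  define \<delta>' where "\<delta>' = \<delta> / (1 + ?e)"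
  have \<delta>': "\<delta>' > 0" using \<delta> e by (simp add: \<delta>'_def)
  obtain N1 where N1: "N1 \<ge> 1" "\<And>n z. n \<ge> N1 \<Longrightarrow> norm z \<le> r \<Longrightarrow> z \<notin> \<psi> ` {w. inverse (1 + ?e) < norm w} \<Longrightarrow>
      norm (W n z + 1) < \<eta>"
    using W_tendsto_inside[OF \<eta>, of r] by blast
  obtain N2 where N2: "\<And>n w. n \<ge> N2 \<Longrightarrow> 1 + \<delta>' \<le> norm w \<Longrightarrow> M \<le> norm (W n (\<psi> w))"
    using W_large_outside[OF \<delta>', of M] by blast
  show ?thesis
  proof (intro exI[of _ "max N1 N2"] conjI allI impI)
    fix n z assume n: "max N1 N2 \<le> n" and z: "Some z \<in> inside_of A"
    have "Some z \<notin> exterior_disc r" using z r inside_of_disjoint(2)[of A] by blast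
    then have "norm z \<le> r" by (auto simp: exterior_disc_def)
    moreover have "z \<notin> \<psi> ` {w. inverse (1 + ?e) < norm w}"
    proof
      assume "z \<in> \<psi> ` {w. inverse (1 + ?e) < norm w}"
      then obtain w where w: "z = \<psi> w" "inverse (1 + ?e) < norm w" by blast
      have "Some (of_real (1 + ?e) * w) \<in> exterior_disc 1"
        using w(2) e by (auto simp: exterior_disc_def norm_mult field_simps simp del: of_real_add)
      then have "?g (Some (of_real (1 + ?e) * w)) \<in> outside_of C"
        using conformal_iso_continuous(3)[OF ci] by (auto simp: bij_betw_def simp del: of_real_add)
      then have "Some z \<in> outside_of C" using F(2)[OF w(2)] w(1) by simp
      then show False using essential_curve_separates[OF A ess ci gN] z by blast
    qed
    ultimately show "norm (poly (omega \<phi> \<epsilon> A n) z + 1) < \<eta>" using N1(2)[of n z] n by (simp add: poly_omega)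
  next
    fix n z assume n: "max N1 N2 \<le> n" and z: "Some z \<in> outside_of A"
    obtain p where p: "p \<in> insert None (Some ` {z. 1 + ?e + \<delta> \<le> norm z})" "Some z = ?g p" using z \<delta>(2) by blast
    then obtain u where u: "1 + ?e + \<delta> \<le> norm u" "Some z = ?g (Some u)" using gN by auto
    define w where "w = u / of_real (1 + ?e)"
    have uw: "u = of_real (1 + ?e) * w" using e by (simp add: w_def del: of_real_add)
    have "norm w = norm u / (1 + ?e)" using e by (simp add: w_def norm_divide del: of_real_add)
    then have w1: "1 + \<delta>' \<le> norm w" using u(1) e by (simp add: \<delta>'_def field_simps)
    have "inverse (1 + ?e) < 1" using e by (simp add: inverse_less_1_iff)
    then have "inverse (1 + ?e) < norm w" using w1 \<delta>' by linarith
    from F(2)[OF this] u(2) uw have "z = \<psi> w" by simp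
    then show "M \<le> norm (poly (omega \<phi> \<epsilon> A n) z)" using N2[OF _ w1, of n] n by (simp add: poly_omega)
  qed (use N1 in simp)
qed

lemma degree_omega:
  assumes A: "A \<in> annuli" and ac: "admissible_choice A C (\<phi> A) (\<epsilon> A)"
  shows "degree (omega \<phi> \<epsilon> A n) = n"
proof -
  let ?g = "\<phi> A" and ?e = "\<epsilon> A"
  have ci: "conformal_iso ?g (exterior_disc 1) (outside_of C)" and gN: "?g None = None" and e: "?e > 0"
    using ac unfolding admissible_choice_def by simp_all
  obtain F where F: "exterior_map F (1 + ?e)" "leading_coefficient (rescaled_map ?g ?e) = F 0"
    by (rule rescaled_map_expansion[OF ci gN e]) blast
  have "F 0 \<noteq> 0" using F(1) by (simp add: exterior_map_def)
  moreover have "degree (\<Prod>k=1..n. [:- node \<phi> \<epsilon> A n k, 1:]) = n"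
    by (subst degree_prod_eq_sum_degree) auto
  ultimately show ?thesis by (simp add: omega_def F(2))
qed

section \<open>Translations of the sphere\<close>

lemma translation_simps [simp]:
  "translation t None = None" "translation t (Some z) = Some (z - t)"
  by (simp_all add: translation_def)

lemma translation_translation [simp]: "translation s (translation t p) = translation (s + t) p"
  by (cases p) simp_all

lemma translation_0 [simp]: "translation 0 p = p"
  by (cases p) simp_all

lemma continuous_map_translation: "continuous_map riemann_sphere riemann_sphere (translation t)"
proof -
  have "openin riemann_sphere {p. translation t p \<in> U}" if U: "openin riemann_sphere U" for U
  proof -
    have "open ((\<lambda>z. z - t) -` (Some -` U))"
      using U by (intro open_vimage continuous_intros) (simp add: openin_sphere_iff)
    moreover have "(\<lambda>z. z - t) -` (Some -` U) = Some -` {p. translation t p \<in> U}" by auto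
    moreover have "\<exists>r. exterior_disc r \<subseteq> {p. translation t p \<in> U}" if N: "None \<in> {p. translation t p \<in> U}"
    proof -
      obtain r where r: "exterior_disc r \<subseteq> U" using N U by (auto simp: openin_sphere_iff)
      have "translation t p \<in> U" if p: "p \<in> exterior_disc (r + norm t)" for p
      proof (cases p)
        case (Some z)
        then have "r < norm (z - t)" using p norm_triangle_ineq2[of z t] by (auto simp: exterior_disc_def)
        then show ?thesis using r Some by (auto simp: exterior_disc_def)
      qed (use N in simp)
      then show ?thesis by blast
    qed
    ultimately show ?thesis unfolding openin_sphere_iff by simp
  qed
  then show ?thesis by (simp add: continuous_map_def)
qed

lemma homeomorphic_maps_translation:
  "homeomorphic_maps riemann_sphere riemann_sphere (translation t) (translation (- t))"
  by (simp add: homeomorphic_maps_def continuous_map_translation)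

lemma homeomorphic_map_translation: "homeomorphic_map riemann_sphere riemann_sphere (translation t)"
  using homeomorphic_maps_translation by (rule homeomorphic_maps_imp_map)

lemma bij_translation: "bij (translation t)"
  by (rule o_bij[of "translation (- t)"]) (auto simp: fun_eq_iff)

lemma inv_translation: "inv (translation t) = translation (- t)"
  by (rule inv_unique_comp) (auto simp: fun_eq_iff)

lemma translation_image_image [simp]: "translation s ` translation t ` K = translation (s + t) ` K"
  by (simp add: image_image)

lemma translation_image_Int: "translation t ` (K \<inter> L) = translation t ` K \<inter> translation t ` L"
  by (rule image_Int) (use bij_translation bij_is_inj in blast)

lemma translation_image_Compl: "translation t ` (- K) = - translation t ` K"
  by (rule bij_image_Compl_eq) (rule bij_translation)

lemma mem_translation_image_iff: "p \<in> translation t ` K \<longleftrightarrow> translation (- t) p \<in> K"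
  by (auto simp: image_iff) (metis add.right_inverse translation_0 translation_translation)

lemma homeomorphic_space_translation:
  "subtopology riemann_sphere (translation t ` K) homeomorphic_space subtopology riemann_sphere K"
proof -
  have "homeomorphic_maps (subtopology riemann_sphere K) (subtopology riemann_sphere (translation t ` K))
     (translation t) (translation (- t))"
    by (rule homeomorphic_maps_subtopologies[OF homeomorphic_maps_translation]) simp
  then show ?thesis using homeomorphic_space_def homeomorphic_space_sym by blast
qed

text \<open>
One inclusion is the maximality of the component of infinity; the other is the same inclusion for the inverse translation.
\<close>

lemma translation_outside_of:
  assumes N: "None \<notin> K"
  shows "outside_of (translation t ` K) = translation t ` outside_of K"
proof -
  have sub: "translation t ` outside_of K \<subseteq> outside_of (translation t ` K)" if N: "None \<notin> K" for t K
  proof (rule connected_subset_outside_of)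
    show "connectedin riemann_sphere (translation t ` outside_of K)"
      by (rule connectedin_continuous_map_image[OF continuous_map_translation connectedin_outside_of])
    show "translation t ` outside_of K \<inter> translation t ` K = {}"
      using outside_of_disjoint[of K] unfolding translation_image_Int[symmetric] by simp
    have "None \<in> translation t ` outside_of K" using None_in_outside_of[OF N] by (force simp: image_iff)
    moreover have "None \<in> outside_of (translation t ` K)"
      by (rule None_in_outside_of) (use N in \<open>simp add: mem_translation_image_iff\<close>)
    ultimately show "translation t ` outside_of K \<inter> outside_of (translation t ` K) \<noteq> {}" by blast
  qed
  have "None \<notin> translation t ` K" using N by (simp add: mem_translation_image_iff)
  from sub[OF this, of "- t"] have "translation (- t) ` outside_of (translation t ` K) \<subseteq> outside_of K" by simp
  then have "translation t ` translation (- t) ` outside_of (translation t ` K) \<subseteq> translation t ` outside_of K"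
    by (rule image_mono)
  then show ?thesis using sub[OF N] by auto
qed

lemma translation_inside_of:
  assumes "None \<notin> K"
  shows "inside_of (translation t ` K) = translation t ` inside_of K"
  unfolding inside_of_def translation_outside_of[OF assms] translation_image_Compl image_Un by (rule refl)

lemma translation_pi1_injects:
  assumes "pi1_injects C A"
  shows "pi1_injects (translation t ` C) (translation t ` A)"
  unfolding pi1_injects_def
proof (intro conjI allI impI)
  let ?S = "riemann_sphere"
  show "translation t ` C \<subseteq> translation t ` A" using assms by (auto simp: pi1_injects_def)
  have cm: "continuous_map (subtopology ?S (translation s ` K)) (subtopology ?S K) (translation (- s))" for s K
    using continuous_map_from_subtopology[OF continuous_map_translation, of "translation s ` K" "- s"]
    by (auto simp: continuous_map_in_subtopology)
  have hom: "sphere_homotopic_paths (translation (- s) ` K) (translation (- s) \<circ> p) (translation (- s) \<circ> q)"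
    if "sphere_homotopic_paths K p q" for s K p q
  proof -
    have "continuous_map (subtopology ?S K) (subtopology ?S (translation (- s) ` K)) (translation (- s))"
      using cm[of s "translation (- s) ` K"] by simp
    with that show ?thesis unfolding sphere_homotopic_paths_def
      by (rule homotopic_with_compose_continuous_map_left) auto
  qed
  fix p q
  assume *: "pathin (subtopology ?S (translation t ` C)) p \<and> pathin (subtopology ?S (translation t ` C)) q \<and>
    p 0 = p 1 \<and> q 0 = q 1 \<and> p 0 = q 0 \<and> sphere_homotopic_paths (translation t ` A) p q"
  then have "sphere_homotopic_paths A (translation (- t) \<circ> p) (translation (- t) \<circ> q)"
    using hom[of "translation t ` A" p q t] by simp
  moreover have "pathin (subtopology ?S C) (translation (- t) \<circ> p)" "pathin (subtopology ?S C) (translation (- t) \<circ> q)"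
    using * pathin_compose[OF _ cm[of t C]] by blast+
  ultimately have "sphere_homotopic_paths C (translation (- t) \<circ> p) (translation (- t) \<circ> q)"
    using assms * unfolding pi1_injects_def by auto
  from hom[OF this, of "- t"] show "sphere_homotopic_paths (translation t ` C) p q"
    by (simp add: o_def)
qed

lemma translation_annuli:
  assumes A: "A \<in> annuli"
  shows "translation t ` A \<in> annuli"
proof -
  let ?S = "riemann_sphere" and ?T = "translation t"
  note hm = homeomorphic_map_translation[of t]
  obtain U C r where U: "open_annulus U" "A = ?S closure_of U" and r: "r > 0" "A \<inter> exterior_disc r = {}"
    and disc: "topological_disc (outside_of A)" "topological_disc (inside_of A)" and C: "essential_curve A C"
    using A by (auto simp: annuli_def)
  have "open_annulus (?T ` U)"
    using U(1) homeomorphic_map_openness[OF hm, of U] homeomorphic_space_trans[OF homeomorphic_space_translation[of t U]]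
    unfolding open_annulus_def by (intro conjI) (simp, blast)
  moreover have "?T ` A = ?S closure_of (?T ` U)" using homeomorphic_map_closure_of[OF hm, of U] U(2) by simp
  moreover have "?T ` A \<inter> exterior_disc (r + norm t) = {}"
  proof -
    have "p \<notin> exterior_disc (r + norm t)" if "p \<in> ?T ` A" for p
    proof (cases p)
      case None
      then show ?thesis using that annuliD(2)[OF A] by (simp add: mem_translation_image_iff)
    next
      case (Some z)
      then have "Some (z + t) \<in> A" using that by (simp add: mem_translation_image_iff)
      then have "Some (z + t) \<notin> exterior_disc r" using r by blast
      then have "norm (z + t) \<le> r" by (auto simp: exterior_disc_def)
      then show ?thesis using Some norm_triangle_ineq2[of z "- t"] by (auto simp: exterior_disc_def)
    qed
    then show ?thesis by blast
  qed
  moreover have "r + norm t > 0" using r by (simp add: add_pos_nonneg)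
  moreover have "topological_disc (outside_of (?T ` A))"
    using disc(1) homeomorphic_space_trans[OF homeomorphic_space_translation] annuliD(2)[OF A]
    unfolding topological_disc_def by (simp add: translation_outside_of)
  moreover have "topological_disc (inside_of (?T ` A))"
    using disc(2) homeomorphic_space_trans[OF homeomorphic_space_translation] annuliD(2)[OF A]
    unfolding topological_disc_def by (simp add: translation_inside_of)
  moreover have "essential_curve (?T ` A) (?T ` C)"
    unfolding essential_curve_def
  proof (intro conjI)
    show "jordan_curve (?T ` C)"
      using C homeomorphic_space_trans[OF homeomorphic_space_translation]
      unfolding essential_curve_def jordan_curve_def by blast
    show "?T ` C \<subseteq> ?S interior_of ?T ` A"
      using C homeomorphic_map_interior_of[OF hm, of A] unfolding essential_curve_def by auto
    show "pi1_injects (?T ` C) (?T ` A)" using C translation_pi1_injects by (auto simp: essential_curve_def)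
  qed
  ultimately show ?thesis unfolding annuli_def by blast
qed

lemma translation_mutually_exterior:
  assumes "mutually_exterior \<AA>" "\<AA> \<subseteq> annuli"
  shows "mutually_exterior ((`) (translation t) ` \<AA>)"
  unfolding mutually_exterior_def
proof (intro ballI impI)
  fix A B assume "A \<in> (`) (translation t) ` \<AA>" "B \<in> (`) (translation t) ` \<AA>" "A \<noteq> B"
  then obtain A' B' where AB: "A' \<in> \<AA>" "B' \<in> \<AA>" "A = translation t ` A'" "B = translation t ` B'" "A' \<noteq> B'"
    by blast
  then have "B' \<inter> (A' \<union> inside_of A') = {}" using assms(1) by (auto simp: mutually_exterior_def)
  then have "translation t ` (B' \<inter> (A' \<union> inside_of A')) = {}" by simp
  then show "B \<inter> (A \<union> inside_of A) = {}"
    using AB annuliD(2)[of A'] assms(2) unfolding translation_image_Int image_Un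
    by (auto simp: translation_inside_of subset_iff)
qed

lemma translation_union_inside:
  assumes "\<AA> \<subseteq> annuli"
  shows "union_inside ((`) (translation t) ` \<AA>) = translation t ` union_inside \<AA>"
  using annuliD(2) assms unfolding union_inside_def image_UN
  by (auto simp: translation_inside_of subset_iff)

lemma translation_common_outside:
  assumes "\<AA> \<subseteq> annuli" "p \<in> common_outside \<AA>"
  shows "translation t p \<in> common_outside ((`) (translation t) ` \<AA>)"
  using annuliD(2) assms unfolding common_outside_def
  by (auto simp: translation_outside_of subset_iff)

section \<open>The reciprocal of a sum of reciprocals of polynomials\<close>

text \<open>
\<^const>\<open>rational_map\<close> is defined through coprime representatives. Any other representation \<open>a / b\<close> gives the same
values wherever it is not of the form \<open>0 / 0\<close>.
\<close>

lemma rational_map_quotient: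
  fixes a b :: "complex poly"
  assumes b: "b \<noteq> 0"
  shows "poly a z \<noteq> 0 \<or> poly b z \<noteq> 0 \<Longrightarrow> rational_map (to_fract a / to_fract b) (Some z) =
      (if poly b z = 0 then None else Some (poly a z / poly b z))"
    and "degree b < degree a \<Longrightarrow> rational_map (to_fract a / to_fract b) None = None"
proof -
  let ?F = "to_fract a / to_fract b"
  obtain p q where pq: "quot_of_fract ?F = (p, q)" by (cases "quot_of_fract ?F")
  have q: "q \<noteq> 0" using snd_quot_of_fract_nonzero[of ?F] pq by simp
  have cop: "coprime p q" using coprime_quot_of_fract[of ?F] pq by simp
  have "to_fract a / to_fract b = to_fract p / to_fract q"
    using Fract_quot_of_fract[of ?F] pq by (simp add: Fract_conv_to_fract)
  then have "to_fract (a * q) = to_fract (p * b)"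
    using b q by (simp add: field_simps)
  then have eq: "a * q = p * b" by (simp only: to_fract_eq_iff)
  {
    assume ab: "poly a z \<noteq> 0 \<or> poly b z \<noteq> 0"
    have eqz: "poly a z * poly q z = poly p z * poly b z" using arg_cong[OF eq, of "\<lambda>p. poly p z"] by simp
    have cz: "\<not> (poly p z = 0 \<and> poly q z = 0)"
    proof
      assume "poly p z = 0 \<and> poly q z = 0"
      then have "[:- z, 1:] dvd p" "[:- z, 1:] dvd q" by (simp_all add: poly_eq_0_iff_dvd)
      then have "is_unit [:- z, 1:]" using cop by (meson coprime_common_divisor)
      then show False by (simp add: is_unit_iff_degree)
    qed
    show "rational_map ?F (Some z) = (if poly b z = 0 then None else Some (poly a z / poly b z))"
    proof (cases "poly b z = 0")
      case True
      then have "poly q z = 0" using ab eqz by simp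
      then show ?thesis using True by (simp add: rational_map_def pq)
    next
      case False
      have "poly q z \<noteq> 0" using eqz False cz by auto
      then have "poly p z / poly q z = poly a z / poly b z" using False eqz by (simp add: frac_eq_eq)
      then show ?thesis using False \<open>poly q z \<noteq> 0\<close> by (simp add: rational_map_def pq)
    qed
  next
    assume deg: "degree b < degree a"
    then have "a \<noteq> 0" by auto
    then have "p \<noteq> 0" using eq q by auto
    then have "degree a + degree q = degree p + degree b"
      using arg_cong[OF eq, of degree] \<open>a \<noteq> 0\<close> q b by (simp add: degree_mult_eq)
    then have "degree q < degree p" using deg by simp
    then show "rational_map ?F None = None" by (simp add: rational_map_def pq)
  }
qed

text \<open>
\<open>P i\<close> stands for \<open>\<omega>\<^sub>i + 1\<close>, and \<open>R\<close> is the map \<open>z / (\<Sum>\<^sub>i 1 / P\<^sub>i z)\<close> of the sphere. The polynomials \<open>num\<close> and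
\<open>den\<close> represent the sum of the reciprocals as \<open>den / num\<close>.
\<close>

locale reciprocal_sum =
  fixes I :: "'a set" and P :: "'a \<Rightarrow> complex poly" and n :: nat
  assumes fin: "finite I" and ne: "I \<noteq> {}" and n: "1 \<le> n" and deg: "\<And>i. i \<in> I \<Longrightarrow> degree (P i) = n"
begin

definition R :: "csphere \<Rightarrow> csphere" where
  "R = rational_map (to_fract [:0, 1:] * inverse (\<Sum>i\<in>I. inverse (to_fract (P i))))"

definition num :: "complex poly" where "num = (\<Prod>i\<in>I. P i)"
definition den :: "complex poly" where "den = (\<Sum>i\<in>I. \<Prod>j\<in>I - {i}. P j)"

lemma P_nz: "i \<in> I \<Longrightarrow> P i \<noteq> 0"
  using deg n by fastforce

lemma R_eq: "R = rational_map (to_fract ([:0, 1:] * num) / to_fract den)"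
proof -
  have num0: "num \<noteq> 0" using P_nz fin by (simp add: num_def prod_zero_iff)
  have "inverse (to_fract (P i)) = to_fract (\<Prod>j\<in>I - {i}. P j) / to_fract num" if i: "i \<in> I" for i
  proof -
    have eq: "num = P i * (\<Prod>j\<in>I - {i}. P j)" unfolding num_def using prod.remove[OF fin i] .
    have "(\<Prod>j\<in>I - {i}. P j) \<noteq> 0" using num0 eq by auto
    then show ?thesis using P_nz[OF i] by (simp add: eq field_simps)
  qed
  then have "(\<Sum>i\<in>I. inverse (to_fract (P i))) = (\<Sum>i\<in>I. to_fract (\<Prod>j\<in>I - {i}. P j) / to_fract num)"
    by (intro sum.cong) auto
  also have "\<dots> = (\<Sum>i\<in>I. to_fract (\<Prod>j\<in>I - {i}. P j)) / to_fract num" by (simp add: sum_divide_distrib)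
  also have "(\<Sum>i\<in>I. to_fract (\<Prod>j\<in>I - {i}. P j)) = to_fract den"
    unfolding den_def using fin by (induction I rule: finite_induct) auto
  finally have S: "(\<Sum>i\<in>I. inverse (to_fract (P i))) = to_fract den / to_fract num" .
  show ?thesis unfolding R_def S by (simp only: inverse_divide times_divide_eq_right to_fract_mult)
qed

lemma den_eval:
  assumes "\<And>i. i \<in> I \<Longrightarrow> poly (P i) z \<noteq> 0"
  shows "poly den z = (\<Sum>i\<in>I. 1 / poly (P i) z) * poly num z"
proof -
  have "(\<Prod>j\<in>I - {i}. poly (P j) z) = 1 / poly (P i) z * (\<Prod>j\<in>I. poly (P j) z)" if i: "i \<in> I" for i
    using prod.remove[OF fin i, of "\<lambda>j. poly (P j) z"] assms[OF i] by simp
  then show ?thesis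
    unfolding den_def num_def poly_sum poly_prod sum_distrib_right by (intro sum.cong) auto
qed

lemma num_eval_nz: "(\<And>i. i \<in> I \<Longrightarrow> poly (P i) z \<noteq> 0) \<Longrightarrow> poly num z \<noteq> 0"
  using fin by (simp add: num_def poly_prod prod_zero_iff)

lemma R_finite:
  assumes nz: "\<And>i. i \<in> I \<Longrightarrow> poly (P i) z \<noteq> 0" and s: "(\<Sum>i\<in>I. 1 / poly (P i) z) \<noteq> 0"
  shows "R (Some z) = Some (z / (\<Sum>i\<in>I. 1 / poly (P i) z))" "den \<noteq> 0"
proof -
  have d: "poly den z \<noteq> 0" using den_eval[OF nz] num_eval_nz[OF nz] s by simp
  then show den: "den \<noteq> 0" by auto
  have "R (Some z) = Some (poly ([:0, 1:] * num) z / poly den z)"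
    unfolding R_eq using rational_map_quotient(1)[OF den] d by simp
  also have "poly ([:0, 1:] * num) z / poly den z = z / (\<Sum>i\<in>I. 1 / poly (P i) z)"
    using den_eval[OF nz] num_eval_nz[OF nz] by simp
  finally show "R (Some z) = Some (z / (\<Sum>i\<in>I. 1 / poly (P i) z))" .
qed

lemma R_zero:
  assumes i: "i \<in> I" "poly (P i) z = 0" and nz: "\<And>j. j \<in> I - {i} \<Longrightarrow> poly (P j) z \<noteq> 0"
  shows "R (Some z) = Some 0" "den \<noteq> 0"
proof -
  have "(\<Prod>j\<in>I - {k}. poly (P j) z) = 0" if "k \<in> I - {i}" for k
    using that i fin by (intro prod_zero) auto
  then have "poly den z = (\<Prod>j\<in>I - {i}. poly (P j) z)"
    unfolding den_def poly_sum poly_prod by (subst sum.remove[OF fin i(1)]) simp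
  then have d: "poly den z \<noteq> 0" using nz fin by (simp add: prod_zero_iff)
  then show den: "den \<noteq> 0" by auto
  have "poly num z = 0" unfolding num_def poly_prod using i fin by (intro prod_zero) auto
  then show "R (Some z) = Some 0" unfolding R_eq using rational_map_quotient(1)[OF den] d by simp
qed

text \<open>
The \<open>i\<close>-th reciprocal exceeds the others by so much that the sum is larger than \<open>b / r + 1\<close>. If \<open>P i\<close> vanishes at
\<open>z\<close>, the reciprocal is infinite and the value is \<open>0\<close>. The claim \<open>den \<noteq> 0\<close> records that \<open>R\<close> is not degenerate: an
identically vanishing sum would make it the constant \<open>0\<close> through the convention for inverses.
\<close>

lemma R_inside:
  assumes i: "i \<in> I" and small: "norm (poly (P i) z) < 1 / (card I + b / r + 1)"
    and large: "\<And>j. j \<in> I - {i} \<Longrightarrow> 1 \<le> norm (poly (P j) z)"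
    and z: "norm z \<le> b" and r: "0 < r"
  shows "R (Some z) \<in> Some ` ball 0 r" "den \<noteq> 0"
proof -
  have b: "0 \<le> b" using z norm_ge_zero order_trans by blast
  have nz: "poly (P j) z \<noteq> 0" if "j \<in> I - {i}" for j using large[OF that] by auto
  have "R (Some z) \<in> Some ` ball 0 r \<and> den \<noteq> 0"
  proof (cases "poly (P i) z = 0")
    case True
    then show ?thesis using R_zero[OF i True nz] r by simp
  next
    case False
    define s where "s = (\<Sum>j\<in>I. 1 / poly (P j) z)"
    have s: "s = 1 / poly (P i) z + (\<Sum>j\<in>I - {i}. 1 / poly (P j) z)"
      unfolding s_def by (rule sum.remove[OF fin i])
    have "norm (\<Sum>j\<in>I - {i}. 1 / poly (P j) z) \<le> (\<Sum>j\<in>I - {i}. 1)"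
      using large by (intro sum_norm_le) (simp add: norm_divide divide_le_eq_1)
    also have "\<dots> \<le> real (card I)" using fin by (simp add: card_mono)
    finally have rest: "norm (\<Sum>j\<in>I - {i}. 1 / poly (P j) z) \<le> real (card I)" .
    have pos: "0 < card I + b / r + 1" using b r by (simp add: add_nonneg_pos)
    have "card I + b / r + 1 < norm (1 / poly (P i) z)"
      using small pos False by (simp add: norm_divide field_simps)
    then have ns: "b / r + 1 < norm s"
      using rest norm_diff_ineq[of "1 / poly (P i) z" "\<Sum>j\<in>I - {i}. 1 / poly (P j) z"] s by simp
    moreover have "0 \<le> b / r" using b r by simp
    ultimately have s0: "0 < norm s" by linarith
    have "norm (z / s) < r"
    proof -
      have "norm z \<le> b" by (rule z)
      also have "b < (b / r + 1) * r" using r by (simp add: field_simps)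
      also have "\<dots> \<le> norm s * r" using ns r by (intro mult_right_mono) auto
      finally show ?thesis using s0 by (simp add: norm_divide field_simps)
    qed
    have allnz: "poly (P j) z \<noteq> 0" if "j \<in> I" for j using nz[of j] False that by (cases "j = i") auto
    have "s \<noteq> 0" using s0 by auto
    from R_finite[OF allnz this[unfolded s_def]] \<open>norm (z / s) < r\<close> show ?thesis
      by (simp add: s_def)
  qed
  then show "R (Some z) \<in> Some ` ball 0 r" "den \<noteq> 0" by auto
qed

lemma R_outside:
  fixes K :: real
  assumes den: "den \<noteq> 0" and large: "\<And>i. i \<in> I \<Longrightarrow> card I * K \<le> norm (poly (P i) z)"
    and K: "0 < K" and z: "z \<noteq> 0"
  shows "R (Some z) = None \<or> (\<exists>u. R (Some z) = Some u \<and> K * norm z \<le> norm u)"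
proof -
  have m: "0 < card I" using fin ne by (simp add: card_gt_0_iff)
  then have mK: "0 < card I * K" using K by simp
  have nz: "poly (P i) z \<noteq> 0" if "i \<in> I" for i using large[OF that] mK by auto
  define s where "s = (\<Sum>i\<in>I. 1 / poly (P i) z)"
  show ?thesis
  proof (cases "s = 0")
    case True
    then have "poly den z = 0" using den_eval[OF nz] by (simp add: s_def)
    moreover have "poly ([:0, 1:] * num) z \<noteq> 0" using num_eval_nz[OF nz] z by simp
    ultimately show ?thesis unfolding R_eq using rational_map_quotient(1)[OF den] by simp
  next
    case False
    have "norm s \<le> (\<Sum>i\<in>I. 1 / (card I * K))"
      unfolding s_def
    proof (rule sum_norm_le)
      fix i assume "i \<in> I"
      then show "norm (1 / poly (P i) z) \<le> 1 / (card I * K)"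
        using large[of i] mK by (simp add: norm_divide frac_le)
    qed
    also have "\<dots> = 1 / K" using m by simp
    finally have "norm s * K \<le> 1" using K by (simp add: field_simps)
    then have "norm z * (norm s * K) \<le> norm z * 1" by (intro mult_left_mono) auto
    then have "K * norm z \<le> norm (z / s)" using False by (simp add: norm_divide field_simps)
    then show ?thesis using R_finite(1)[OF nz False[unfolded s_def]] by (simp add: s_def)
  qed
qed

text \<open>
Cancellation can only lower the degree of the sum of products \<open>den\<close>, so the degree of \<open>[:0, 1:] * num\<close> is always larger.
\<close>

lemma R_None:
  assumes den: "den \<noteq> 0" shows "R None = None"
proof -
  have num0: "num \<noteq> 0" using P_nz fin by (simp add: num_def prod_zero_iff)
  have m: "0 < card I" using fin ne by (simp add: card_gt_0_iff)
  have "degree num = (\<Sum>i\<in>I. degree (P i))"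
    unfolding num_def by (rule degree_prod_eq_sum_degree) (use P_nz in blast)
  then have "degree num = card I * n" using deg by simp
  then have dn: "degree ([:0, 1:] * num) = card I * n + 1" using num0 by (simp add: degree_mult_eq)
  have "degree den \<le> card I * n"
    unfolding den_def
  proof (rule degree_sum_le[OF fin])
    fix i assume i: "i \<in> I"
    have "degree (\<Prod>j\<in>I - {i}. P j) = (\<Sum>j\<in>I - {i}. degree (P j))"
      by (rule degree_prod_eq_sum_degree) (use P_nz in blast)
    also have "\<dots> = card (I - {i}) * n" using deg by simp
    also have "\<dots> \<le> card I * n" using fin by (intro mult_right_mono card_mono) auto
    finally show "degree (\<Prod>j\<in>I - {i}. P j) \<le> card I * n" .
  qed
  then show ?thesis unfolding R_eq using rational_map_quotient(2)[OF den, of "[:0, 1:] * num"] dn by simp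
qed

lemma P_large:
  "\<exists>b. \<forall>z. b \<le> norm z \<longrightarrow> (\<forall>i\<in>I. d \<le> norm (poly (P i) z))"
proof -
  have "\<exists>b. \<forall>z. b \<le> norm z \<longrightarrow> d \<le> norm (poly (P i) z)" if "i \<in> I" for i
  proof -
    obtain a p where ap: "P i = pCons a p" by (cases "P i")
    then have "p \<noteq> 0" using deg[OF that] n by auto
    from poly_infinity[OF this, of d a] show ?thesis by (simp add: ap)
  qed
  then obtain b where b: "\<And>i z. i \<in> I \<Longrightarrow> b i \<le> norm z \<Longrightarrow> d \<le> norm (poly (P i) z)" by metis
  have "b i \<le> Max (b ` I)" if "i \<in> I" for i using that fin by simp
  then have "\<forall>z. Max (b ` I) \<le> norm z \<longrightarrow> (\<forall>i\<in>I. d \<le> norm (poly (P i) z))"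
    using b order_trans by blast
  then show ?thesis by blast
qed

end

section \<open>Dynamics near infinity\<close>

text \<open>
This says \<open>f(z)/z \<longlonglongrightarrow> \<infinity>\<close> as \<open>z \<longlonglongrightarrow> \<infinity>\<close>, with poles allowed. For a rational map that
fixes infinity it amounts to multiplier \<open>0\<close> there, and it is easier to conjugate by translations than the derivative.
\<close>

definition superlinear_at_infinity :: "(csphere \<Rightarrow> csphere) \<Rightarrow> bool" where
  "superlinear_at_infinity f \<longleftrightarrow>
     (\<forall>K. \<exists>b. \<forall>z. b \<le> norm z \<longrightarrow> f (Some z) = None \<or> (\<exists>u. f (Some z) = Some u \<and> K * norm z \<le> norm u))"

lemma (in reciprocal_sum) superlinear_R:
  assumes "den \<noteq> 0"
  shows "superlinear_at_infinity R"
  unfolding superlinear_at_infinity_def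
proof
  fix K :: real
  define K' where "K' = max K 1"
  have K': "0 < K'" "K \<le> K'" by (auto simp: K'_def)
  obtain b where b: "\<And>z. b \<le> norm z \<Longrightarrow> \<forall>i\<in>I. card I * K' \<le> norm (poly (P i) z)"
    using P_large by blast
  show "\<exists>b. \<forall>z. b \<le> norm z \<longrightarrow> R (Some z) = None \<or> (\<exists>u. R (Some z) = Some u \<and> K * norm z \<le> norm u)"
  proof (intro exI[of _ "max b 1"] allI impI)
    fix z :: complex assume z: "max b 1 \<le> norm z"
    then have "z \<noteq> 0" by auto
    then have "R (Some z) = None \<or> (\<exists>u. R (Some z) = Some u \<and> K' * norm z \<le> norm u)"
      using R_outside[OF assms _ K'(1)] b[of z] z by auto
    moreover have "K * norm z \<le> K' * norm z" using K' by (intro mult_right_mono) auto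
    ultimately show "R (Some z) = None \<or> (\<exists>u. R (Some z) = Some u \<and> K * norm z \<le> norm u)"
      using order_trans by blast
  qed
qed

lemma superlinear_imp_attracting:
  assumes sl: "superlinear_at_infinity f" and fN: "f None = None"
  shows "attracting_fixed_point_at_infinity f"
proof -
  define G where "G w = the (sphere_inverse (f (sphere_inverse (Some w))))" for w
  have G0: "G 0 = 0" by (simp add: G_def sphere_inverse_def fN)
  have "(\<lambda>h. (G (0 + h) - G 0) / h) \<midarrow>0\<rightarrow> 0"
  proof (rule LIM_I)
    fix e :: real assume e: "0 < e"
    obtain b where b: "\<And>z. b \<le> norm z \<Longrightarrow>
        f (Some z) = None \<or> (\<exists>u. f (Some z) = Some u \<and> (2 / e) * norm z \<le> norm u)"
      using sl unfolding superlinear_at_infinity_def by blast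
    define s where "s = 1 / (\<bar>b\<bar> + 1)"
    have "norm ((G (0 + h) - G 0) / h - 0) < e" if h: "h \<noteq> 0 \<and> norm (h - 0) < s" for h
    proof -
      have h0: "h \<noteq> 0" "0 < norm h" and "norm h < 1 / (\<bar>b\<bar> + 1)" using h by (auto simp: s_def)
      then have "(\<bar>b\<bar> + 1) * norm h < 1" by (simp add: field_simps)
      then have "\<bar>b\<bar> + 1 < 1 / norm h" using h0 by (simp add: pos_less_divide_eq)
      then have "\<bar>b\<bar> + 1 < norm (inverse h)" by (simp add: norm_inverse divide_inverse)
      then have bz: "b \<le> norm (inverse h)" by linarith
      show ?thesis
      proof (cases "f (Some (inverse h))")
        case None
        then show ?thesis using h0 e by (simp add: G0) (simp add: G_def sphere_inverse_def)
      next
        case (Some u)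
        then have u: "(2 / e) * norm (inverse h) \<le> norm u" using b[OF bz] by auto
        moreover have "0 < (2 / e) * norm (inverse h)" using e h0 by simp
        ultimately have u0: "u \<noteq> 0" by auto
        have "G h = inverse u" using Some h0 u0 by (simp add: G_def sphere_inverse_def)
        then have "norm (G h / h) = 1 / (norm u * norm h)" by (simp add: norm_divide norm_inverse norm_mult field_simps)
        also have "\<dots> \<le> e / 2"
        proof -
          have "(2 / e) * norm (inverse h) * norm h \<le> norm u * norm h" using u by (intro mult_right_mono) auto
          moreover have "norm (inverse h) * norm h = 1" using h0 by (simp add: norm_inverse)
          ultimately have "2 / e \<le> norm u * norm h" by (simp only: mult.assoc mult_1_right)
          then show ?thesis using e frac_le[of 1 1 "2 / e" "norm u * norm h"] by simp
        qed
        also have "\<dots> < e" using e by simp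
        finally show ?thesis using G0 by simp
      qed
    qed
    moreover have "0 < s" by (simp add: s_def add_nonneg_pos)
    ultimately show "\<exists>s>0. \<forall>x. x \<noteq> 0 \<and> norm (x - 0) < s \<longrightarrow> norm ((G (0 + x) - G 0) / x - 0) < e"
      by blast
  qed
  then have "(G has_field_derivative 0) (at 0)" by (simp add: DERIV_def)
  then show ?thesis unfolding attracting_fixed_point_at_infinity_def G_def[abs_def] using fN
    by (intro conjI exI[of _ 0]) auto
qed

lemma superlinear_conjugate:
  assumes sl: "superlinear_at_infinity f"
  shows "superlinear_at_infinity (translation (- t) \<circ> f \<circ> translation t)"
  unfolding superlinear_at_infinity_def
proof
  fix K :: real
  define K' where "K' = 2 * \<bar>K\<bar> + 2"
  obtain b where b: "\<And>z. b \<le> norm z \<Longrightarrow>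
      f (Some z) = None \<or> (\<exists>u. f (Some z) = Some u \<and> K' * norm z \<le> norm u)"
    using sl unfolding superlinear_at_infinity_def by blast
  let ?f = "translation (- t) \<circ> f \<circ> translation t"
  show "\<exists>b. \<forall>z. b \<le> norm z \<longrightarrow> ?f (Some z) = None \<or> (\<exists>u. ?f (Some z) = Some u \<and> K * norm z \<le> norm u)"
  proof (intro exI[of _ "max (b + norm t) (2 * norm t)"] allI impI)
    fix z :: complex assume z: "max (b + norm t) (2 * norm t) \<le> norm z"
    have tri: "norm z - norm t \<le> norm (z - t)" by (rule norm_triangle_ineq2)
    then have "b \<le> norm (z - t)" using z by linarith
    from b[OF this] show "?f (Some z) = None \<or> (\<exists>u. ?f (Some z) = Some u \<and> K * norm z \<le> norm u)"
    proof
      assume "\<exists>u. f (Some (z - t)) = Some u \<and> K' * norm (z - t) \<le> norm u"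
      then obtain u where u: "f (Some (z - t)) = Some u" "K' * norm (z - t) \<le> norm u" by blast
      have "norm z / 2 \<le> norm (z - t)" using tri z by linarith
      then have "K' * (norm z / 2) \<le> K' * norm (z - t)" by (intro mult_left_mono) (auto simp: K'_def)
      then have "\<bar>K\<bar> * norm z + norm z \<le> norm u" using u(2) by (simp add: K'_def algebra_simps)
      moreover have "K * norm z \<le> \<bar>K\<bar> * norm z" by (intro mult_right_mono) auto
      moreover have "norm u - norm t \<le> norm (u + t)" using norm_triangle_ineq2[of u "- t"] by simp
      moreover have "norm t \<le> norm z" using z norm_ge_zero[of t] by linarith
      ultimately have "K * norm z \<le> norm (u + t)" by linarith
      then show ?thesis using u(1) by simp
    qed simp
  qed
qed

lemma iterate_conjugate:
  "((translation (- t) \<circ> f \<circ> translation t) ^^ k) p = translation (- t) ((f ^^ k) (translation t p))"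
  by (induction k) simp_all

lemma basin_conjugate:
  "p \<in> basin (translation (- t) \<circ> f \<circ> translation t) \<longleftrightarrow> translation t p \<in> basin f"
proof -
  have lim: "limitin riemann_sphere (\<lambda>k. translation s (q k)) None sequentially"
    if "limitin riemann_sphere q None sequentially" for s q
    using continuous_map_limit[OF continuous_map_translation[of s] that] by (simp add: o_def)
  show ?thesis
    unfolding basin_def iterate_conjugate mem_Collect_eq
    using lim[of "\<lambda>k. (f ^^ k) (translation t p)" "- t"]
      lim[of "\<lambda>k. translation (- t) ((f ^^ k) (translation t p))" t] by auto
qed

text \<open>
As long as the orbit stays finite it stays in \<open>V\<close>, and its modulus doubles at every step.
\<close>

lemma expanding_imp_basin:
  assumes fN: "f None = None"
    and step: "\<And>z. z \<in> V \<Longrightarrow> f (Some z) = None \<or> (\<exists>u\<in>V. f (Some z) = Some u \<and> 2 * norm z \<le> norm u)"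
    and z: "z \<in> V" "z \<noteq> 0"
  shows "Some z \<in> basin f"
proof -
  have it: "(f ^^ k) (Some z) = None \<or> (\<exists>u\<in>V. (f ^^ k) (Some z) = Some u \<and> 2 ^ k * norm z \<le> norm u)" for k
  proof (induction k)
    case (Suc k)
    from Suc show ?case
    proof
      assume "\<exists>u\<in>V. (f ^^ k) (Some z) = Some u \<and> 2 ^ k * norm z \<le> norm u"
      then obtain u where u: "u \<in> V" "(f ^^ k) (Some z) = Some u" "2 ^ k * norm z \<le> norm u" by blast
      from step[OF u(1)] show ?thesis
      proof
        assume "\<exists>v\<in>V. f (Some u) = Some v \<and> 2 * norm u \<le> norm v"
        then obtain v where "v \<in> V" "f (Some u) = Some v" "2 * norm u \<le> norm v" by blast
        then show ?thesis using u by (intro disjI2 bexI[of _ v]) auto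
      qed (use u in simp)
    qed (simp add: fN)
  qed (use z in simp)
  have "\<forall>\<^sub>F k in sequentially. (f ^^ k) (Some z) \<in> U" if U: "openin riemann_sphere U" "None \<in> U" for U
  proof -
    obtain b where b: "exterior_disc b \<subseteq> U" using U by (auto simp: openin_sphere_iff)
    obtain k0 where "b / norm z < 2 ^ k0" using real_arch_pow[of 2 "b / norm z"] by auto
    then have k0: "b < 2 ^ k0 * norm z" using z by (simp add: field_simps)
    have "(f ^^ k) (Some z) \<in> U" if k: "k0 \<le> k" for k
    proof -
      have "(2::real) ^ k0 * norm z \<le> 2 ^ k * norm z" using k by (intro mult_right_mono power_increasing) auto
      then have "b < 2 ^ k * norm z" using k0 by linarith
      then have "(f ^^ k) (Some z) \<in> exterior_disc b" using it[of k] by (auto simp: exterior_disc_def)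
      then show ?thesis using b by blast
    qed
    then show ?thesis unfolding eventually_sequentially by blast
  qed
  then show ?thesis by (simp add: basin_def limitin_def)
qed

lemma invariant_bounded_imp_filled_julia:
  assumes inv: "\<And>p. p \<in> V \<Longrightarrow> f p \<in> V" and V: "V \<inter> exterior_disc b = {}" and p: "p \<in> V"
  shows "p \<in> filled_julia f"
proof -
  have it: "(f ^^ k) p \<in> V" for k by (induction k) (use p inv in auto)
  have "\<not> limitin riemann_sphere (\<lambda>k. (f ^^ k) p) None sequentially"
  proof
    assume "limitin riemann_sphere (\<lambda>k. (f ^^ k) p) None sequentially"
    moreover have "openin riemann_sphere (exterior_disc b)" by (rule openin_exterior_disc)
    moreover have "None \<in> exterior_disc b" by (simp add: exterior_disc_def)
    ultimately have "\<forall>\<^sub>F k in sequentially. (f ^^ k) p \<in> exterior_disc b" unfolding limitin_def by blast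
    then obtain k where "(f ^^ k) p \<in> exterior_disc b" unfolding eventually_sequentially by blast
    then show False using it[of k] V by blast
  qed
  then show ?thesis by (simp add: filled_julia_def basin_def)
qed

section \<open>The Julia set and the annuli\<close>

lemma inside_subset_outside_if_exterior:
  assumes "mutually_exterior \<AA>" "\<AA> \<subseteq> annuli" "A \<in> \<AA>" "B \<in> \<AA>" "A \<noteq> B"
  shows "inside_of A \<subseteq> outside_of B"
proof -
  have "B \<inter> (A \<union> inside_of A) = {}" "A \<inter> (B \<union> inside_of B) = {}"
    using assms unfolding mutually_exterior_def by blast+
  then show ?thesis using assms by (intro inside_subset_outside) auto
qed

lemma julia_subset_union:
  assumes fin: "finite \<AA>" and sub: "\<AA> \<subseteq> annuli"
    and K: "union_inside \<AA> \<subseteq> filled_julia f" and L: "common_outside \<AA> \<subseteq> basin f"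
  shows "julia f \<subseteq> \<Union>\<AA>"
proof
  fix p assume p: "p \<in> julia f"
  have open_in: "openin riemann_sphere (union_inside \<AA>)"
    unfolding union_inside_def using open_inside_outside(2) annuliD(1,2) sub by (intro openin_Union) blast
  have open_out: "openin riemann_sphere (common_outside \<AA>)"
  proof (cases "\<AA> = {}")
    case True
    then show ?thesis using openin_topspace[of riemann_sphere] by (simp add: common_outside_def)
  next
    case False
    then show ?thesis
      unfolding common_outside_def using open_inside_outside(1) annuliD(1,2) sub fin by (intro openin_Inter) auto
  qed
  have "p \<notin> union_inside \<AA>"
    using p interior_of_maximal[OF K open_in] by (auto simp: julia_def frontier_of_def)
  moreover have "p \<notin> common_outside \<AA>"
  proof
    assume "p \<in> common_outside \<AA>"
    moreover have "common_outside \<AA> \<inter> filled_julia f = {}" using L by (auto simp: filled_julia_def)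
    ultimately have "p \<notin> riemann_sphere closure_of filled_julia f"
      using open_out unfolding in_closure_of by blast
    then show False using p by (simp add: julia_def frontier_of_def)
  qed
  ultimately obtain A where "A \<in> \<AA>" "p \<notin> outside_of A" "p \<notin> inside_of A"
    unfolding union_inside_def common_outside_def by blast
  then show "p \<in> \<Union>\<AA>" using UNIV_inside_outside by blast
qed

text \<open>
The start of the path need not be in the common outside: it may lie in another annulus or inside it. But the filled annuli
are disjoint closed sets, so the connected path cannot pass from one to another without leaving them all,
and it leaves them only into the basin.
\<close>

lemma path_meets_julia:
  assumes fin: "finite \<AA>" and sub: "\<AA> \<subseteq> annuli" and ext: "mutually_exterior \<AA>"
    and K: "union_inside \<AA> \<subseteq> filled_julia f" and L: "common_outside \<AA> \<subseteq> basin f"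
    and A: "A \<in> \<AA>" and p: "pathin riemann_sphere p" "p 0 \<in> outside_of A" "p 1 \<in> inside_of A"
  shows "p ` {0..1} \<inter> julia f \<noteq> {}"
proof -
  let ?S = "riemann_sphere"
  let ?P = "p ` {0..1}"
  have "connectedin (top_of_set {0..1::real}) {0..1}" by (simp add: connectedin_absolute)
  then have conP: "connectedin ?S ?P"
    using p(1) unfolding pathin_def by (intro connectedin_continuous_map_image)
  have p01: "p 0 \<in> ?P" "p 1 \<in> ?P" by auto
  have closed_fill: "closedin ?S (- outside_of B)" if "B \<in> \<AA>" for B
    using open_inside_outside(1) annuliD(1,2) sub that by (simp add: closedin_sphere_iff subset_iff)
  have fill: "- outside_of B = B \<union> inside_of B" for B
    using outside_of_disjoint[of B] by (auto simp: inside_of_def)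
  have disj: "(- outside_of B) \<inter> (- outside_of B') = {}" if "B \<in> \<AA>" "B' \<in> \<AA>" "B \<noteq> B'" for B B'
  proof -
    have "B' \<inter> (B \<union> inside_of B) = {}" "B \<inter> (B' \<union> inside_of B') = {}"
      using ext that unfolding mutually_exterior_def by blast+
    then show ?thesis
      using inside_subset_outside_if_exterior[OF ext sub that] inside_of_disjoint(2)[of B'] unfolding fill by blast
  qed
  have "?P \<inter> common_outside \<AA> \<noteq> {}"
  proof
    assume "?P \<inter> common_outside \<AA> = {}"
    then have cover: "?P \<subseteq> - outside_of A \<union> (\<Union>B\<in>\<AA> - {A}. - outside_of B)"
      by (auto simp: common_outside_def)
    have "closedin ?S (\<Union>B\<in>\<AA> - {A}. - outside_of B)"
      using closed_fill fin by (intro closedin_Union) auto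
    moreover have "(- outside_of A) \<inter> (\<Union>B\<in>\<AA> - {A}. - outside_of B) \<inter> ?P = {}"
      using disj[OF A] by blast
    moreover have "p 1 \<in> - outside_of A" using p(3) inside_of_disjoint(2)[of A] by blast
    then have "(- outside_of A) \<inter> ?P \<noteq> {}" using p01 by blast
    moreover have "(\<Union>B\<in>\<AA> - {A}. - outside_of B) \<inter> ?P \<noteq> {}" using p(2) p01 cover by blast
    ultimately show False using conP closed_fill[OF A] cover unfolding connectedin_closedin by blast
  qed
  then have "?P - filled_julia f \<noteq> {}" using L by (auto simp: filled_julia_def)
  moreover have "p 1 \<in> filled_julia f" using K A p(3) by (auto simp: union_inside_def)
  then have "?P \<inter> filled_julia f \<noteq> {}" using p01 by blast
  ultimately show ?thesis unfolding julia_def by (intro connectedin_Int_frontier_of[OF conP])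
qed

text \<open>
The constants: the ball of radius \<open>r\<close> about \<open>0\<close> lies in one bounded side, all bounded sides lie in the ball of
radius \<open>b\<close>. The map sends every bounded side into the small ball. On the common outside \<open>\<bar>z\<bar> \<ge> r\<close>, so
expansion by \<open>K\<close> with \<open>K r > b\<close> sends it beyond radius \<open>b\<close>, back into the common outside, and \<open>K \<ge> 2\<close> makes
the orbit escape.
\<close>

lemma R_map_dynamics:
  assumes choices: "\<forall>A\<in>annuli. admissible_choice A (\<gamma> A) (\<phi> A) (\<epsilon> A)"
    and fin: "finite \<AA>" and sub: "\<AA> \<subseteq> annuli" and ext: "mutually_exterior \<AA>"
    and zero: "Some 0 \<in> union_inside \<AA>"
  shows "\<exists>N. \<forall>n\<ge>N. R_map \<phi> \<epsilon> \<AA> n None = None \<and> superlinear_at_infinity (R_map \<phi> \<epsilon> \<AA> n) \<and>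
     union_inside \<AA> \<subseteq> filled_julia (R_map \<phi> \<epsilon> \<AA> n) \<and> common_outside \<AA> \<subseteq> basin (R_map \<phi> \<epsilon> \<AA> n)"
proof -
  have ne: "\<AA> \<noteq> {}" using zero by (auto simp: union_inside_def)
  note ann = subsetD[OF sub]
  obtain A0 where A0: "A0 \<in> \<AA>" "Some 0 \<in> inside_of A0" using zero by (auto simp: union_inside_def)
  obtain r where r: "0 < r" "Some ` ball 0 r \<subseteq> inside_of A0"
  proof -
    have "open (Some -` inside_of A0)"
      using open_inside_outside(2)[OF annuliD(1,2)[OF ann[OF A0(1)]]] by (simp add: openin_sphere_iff)
    then obtain r where "0 < r" "ball 0 r \<subseteq> Some -` inside_of A0" using A0(2) by (metis openE vimageI)
    then show thesis by (intro that[of r]) auto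
  qed
  obtain b where b: "0 < b" "\<And>A. A \<in> \<AA> \<Longrightarrow> exterior_disc b \<subseteq> outside_of A"
  proof -
    have "\<exists>c. exterior_disc c \<subseteq> outside_of A" if "A \<in> \<AA>" for A using annuliD(5)[OF ann[OF that]] by blast
    then obtain c where c: "\<And>A. A \<in> \<AA> \<Longrightarrow> exterior_disc (c A) \<subseteq> outside_of A" by metis
    have "exterior_disc (max 1 (Max (c ` \<AA>))) \<subseteq> outside_of A" if "A \<in> \<AA>" for A
    proof -
      have "c A \<le> Max (c ` \<AA>)" using that fin by simp
      then have "exterior_disc (max 1 (Max (c ` \<AA>))) \<subseteq> exterior_disc (c A)" by (auto simp: exterior_disc_def)
      then show ?thesis using c[OF that] by blast
    qed
    then show thesis by (intro that[of "max 1 (Max (c ` \<AA>))"]) auto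
  qed
  define K where "K = max 2 ((b + 1) / r)"
  have K: "2 \<le> K" "b < K * r"
  proof -
    have "(b + 1) / r * r \<le> K * r" using r(1) by (intro mult_right_mono) (auto simp: K_def)
    then show "b < K * r" using r(1) by simp
  qed (simp add: K_def)
  define \<eta> where "\<eta> = 1 / (card \<AA> + b / r + 1)"
  have \<eta>: "0 < \<eta>" using b(1) r(1) by (simp add: \<eta>_def add_nonneg_pos)
  have "\<exists>N\<ge>1. \<forall>n\<ge>N.
    (\<forall>z. Some z \<in> inside_of A \<longrightarrow> norm (poly (omega \<phi> \<epsilon> A n) z + 1) < \<eta>) \<and>
    (\<forall>z. Some z \<in> outside_of A \<longrightarrow> card \<AA> * K + 1 \<le> norm (poly (omega \<phi> \<epsilon> A n) z))" if "A \<in> \<AA>" for A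
    using omega_asymptotics[OF ann[OF that] _ \<eta>] choices ann[OF that] by blast
  then obtain N where N: "\<And>A. A \<in> \<AA> \<Longrightarrow> N A \<ge> 1"
    "\<And>A n z. A \<in> \<AA> \<Longrightarrow> N A \<le> n \<Longrightarrow> Some z \<in> inside_of A \<Longrightarrow> norm (poly (omega \<phi> \<epsilon> A n) z + 1) < \<eta>"
    "\<And>A n z. A \<in> \<AA> \<Longrightarrow> N A \<le> n \<Longrightarrow> Some z \<in> outside_of A \<Longrightarrow> card \<AA> * K + 1 \<le> norm (poly (omega \<phi> \<epsilon> A n) z)"
    by metis
  show ?thesis
  proof (intro exI[of _ "Max (N ` \<AA>)"] allI impI)
    fix n assume n: "Max (N ` \<AA>) \<le> n"
    have nN: "N A \<le> n" if "A \<in> \<AA>" for A using n that fin by (meson Max_ge finite_imageI imageI order_trans)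
    have n1: "1 \<le> n" using N(1)[OF A0(1)] nN[OF A0(1)] by simp
    define P where "P A = omega \<phi> \<epsilon> A n + 1" for A
    interpret reciprocal_sum \<AA> P n
    proof
      fix A assume A: "A \<in> \<AA>"
      have "degree (omega \<phi> \<epsilon> A n) = n" using degree_omega[OF ann[OF A]] choices ann[OF A] by blast
      then show "degree (P A) = n" unfolding P_def using n1 by (subst degree_add_eq_left) auto
    qed (use fin ne n1 in auto)
    have RR: "R_map \<phi> \<epsilon> \<AA> n = R"
      by (simp add: R_map_def R_def Omega_def P_def)
    have small: "norm (poly (P A) z) < \<eta>" if "A \<in> \<AA>" "Some z \<in> inside_of A" for A z
      using N(2)[OF that(1) nN[OF that(1)] that(2)] by (simp add: P_def)
    have large: "card \<AA> * K \<le> norm (poly (P A) z)" if "A \<in> \<AA>" "Some z \<in> outside_of A" for A z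
      using N(3)[OF that(1) nN[OF that(1)] that(2)] norm_diff_ineq[of "poly (omega \<phi> \<epsilon> A n) z" 1]
      by (simp add: P_def)
    have "1 \<le> card \<AA>" using fin ne by (simp add: Suc_le_eq card_gt_0_iff)
    then have "1 * 2 \<le> card \<AA> * K" using K(1) by (intro mult_mono) auto
    then have large1: "1 \<le> norm (poly (P A) z)" if "A \<in> \<AA>" "Some z \<in> outside_of A" for A z
      using large[OF that] by linarith
    have in_bounded: "norm z \<le> b" if "A \<in> \<AA>" "Some z \<in> inside_of A" for A z
    proof -
      have "Some z \<notin> exterior_disc b" using that b(2) inside_of_disjoint(2)[of A] by blast
      then show ?thesis by (auto simp: exterior_disc_def)
    qed
    have N_in: "None \<notin> inside_of A" if "A \<in> \<AA>" for A
      using None_in_outside_of[OF annuliD(2)[OF ann[OF that]]] inside_of_disjoint(2)[of A] by blast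
    have step_in: "R (Some z) \<in> Some ` ball 0 r \<and> den \<noteq> 0" if A: "A \<in> \<AA>" and z: "Some z \<in> inside_of A" for A z
    proof -
      have "1 \<le> norm (poly (P B) z)" if "B \<in> \<AA> - {A}" for B
        using large1[of B z] inside_subset_outside_if_exterior[OF ext sub A, of B] that z by blast
      then show ?thesis
        using R_inside[OF A, of z b r] small[OF A z] in_bounded[OF A z] r(1) unfolding \<eta>_def by blast
    qed
    have den: "den \<noteq> 0" using step_in[OF A0] by blast
    have inv: "R p \<in> union_inside \<AA>" if p: "p \<in> union_inside \<AA>" for p
    proof -
      obtain A where A: "A \<in> \<AA>" "p \<in> inside_of A" using p by (auto simp: union_inside_def)
      then obtain z where "p = Some z" using N_in by (cases p) auto
      then have "R p \<in> inside_of A0" using step_in[of A z] A r(2) by blast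
      then show ?thesis using A0(1) by (auto simp: union_inside_def)
    qed
    have "union_inside \<AA> \<inter> exterior_disc b = {}"
      using b(2) inside_of_disjoint(2) unfolding union_inside_def by blast
    then have K_sub: "union_inside \<AA> \<subseteq> filled_julia R"
      using invariant_bounded_imp_filled_julia[of "union_inside \<AA>" R b] inv by blast
    define V where "V = {z. Some z \<in> common_outside \<AA>}"
    have Vr: "r \<le> norm z" if "z \<in> V" for z
    proof (rule ccontr)
      assume "\<not> r \<le> norm z"
      then have "Some z \<in> inside_of A0" using r(2) by auto
      moreover have "Some z \<in> outside_of A0" using that A0(1) by (auto simp: V_def common_outside_def)
      ultimately show False using inside_of_disjoint(2)[of A0] by blast
    qed
    have step_out: "R (Some z) = None \<or> (\<exists>u\<in>V. R (Some z) = Some u \<and> 2 * norm z \<le> norm u)" if z: "z \<in> V" for z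
    proof -
      have zA: "Some z \<in> outside_of A" if "A \<in> \<AA>" for A using z that by (auto simp: V_def common_outside_def)
      have "z \<noteq> 0" using Vr[OF z] r(1) by auto
      then have "R (Some z) = None \<or> (\<exists>u. R (Some z) = Some u \<and> K * norm z \<le> norm u)"
        using R_outside[OF den, of K z] large zA K(1) by auto
      then show ?thesis
      proof
        assume "\<exists>u. R (Some z) = Some u \<and> K * norm z \<le> norm u"
        then obtain u where u: "R (Some z) = Some u" "K * norm z \<le> norm u" by blast
        have "K * r \<le> K * norm z" using Vr[OF z] K(1) by (intro mult_left_mono) auto
        then have "b < norm u" using u(2) K(2) by linarith
        then have "Some u \<in> exterior_disc b" by (simp add: exterior_disc_def)
        then have "u \<in> V" using b(2) by (auto simp: V_def common_outside_def)
        moreover have "2 * norm z \<le> K * norm z" using K(1) by (intro mult_right_mono) auto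
        ultimately show ?thesis using u by (intro disjI2 bexI[of _ u]) auto
      qed simp
    qed
    have L_sub: "common_outside \<AA> \<subseteq> basin R"
    proof
      fix p assume p: "p \<in> common_outside \<AA>"
      show "p \<in> basin R"
      proof (cases p)
        case None
        have "(R ^^ k) None = None" for k by (induction k) (simp_all add: R_None[OF den])
        then show ?thesis using None by (simp add: basin_def limitin_def)
      next
        case (Some z)
        then have "z \<in> V" using p by (simp add: V_def)
        moreover have "z \<noteq> 0" using Vr[OF \<open>z \<in> V\<close>] r(1) by auto
        ultimately show ?thesis using expanding_imp_basin[of R V z, OF R_None[OF den] step_out] Some by simp
      qed
    qed
    show "R_map \<phi> \<epsilon> \<AA> n None = None \<and> superlinear_at_infinity (R_map \<phi> \<epsilon> \<AA> n) \<and>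
       union_inside \<AA> \<subseteq> filled_julia (R_map \<phi> \<epsilon> \<AA> n) \<and> common_outside \<AA> \<subseteq> basin (R_map \<phi> \<epsilon> \<AA> n)"
      unfolding RR using R_None[OF den] superlinear_R[OF den] K_sub L_sub by blast
  qed
qed

theorem theorem3p2:
  fixes \<gamma> :: "csphere set \<Rightarrow> csphere set"
    and \<phi> :: "csphere set \<Rightarrow> csphere \<Rightarrow> csphere"
    and \<epsilon> :: "csphere set \<Rightarrow> real"
    and \<AA> :: "csphere set set"
    and t :: complex
  assumes choices: "\<forall>A\<in>annuli. admissible_choice A (\<gamma> A) (\<phi> A) (\<epsilon> A)"
    and "finite \<AA>" and "\<AA> \<subseteq> annuli" and "mutually_exterior \<AA>"
    and "Some t \<in> union_inside \<AA>"
  shows "\<exists>N. \<forall>n\<ge>N.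
    let \<tau> = translation t;
        f = inv \<tau> \<circ> R_map \<phi> \<epsilon> ((`) \<tau> ` \<AA>) n \<circ> \<tau>
    in attracting_fixed_point_at_infinity f \<and>
       union_inside \<AA> \<subseteq> filled_julia f \<and>
       common_outside \<AA> \<subseteq> basin f \<and>
       julia f \<subseteq> \<Union>\<AA> \<and>
       (\<forall>A\<in>\<AA>. \<forall>p. pathin riemann_sphere p \<and> p 0 \<in> outside_of A \<and> p 1 \<in> inside_of A
          \<longrightarrow> p ` {0..1} \<inter> julia f \<noteq> {})"
proof -
  note fin = assms(2) and sub = assms(3) and ext = assms(4) and t = assms(5)
  let ?\<BB> = "(`) (translation t) ` \<AA>"
  have subB: "?\<BB> \<subseteq> annuli" using translation_annuli sub by blast
  have zero: "Some 0 \<in> union_inside ?\<BB>"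
    using t unfolding translation_union_inside[OF sub] by (force simp: image_iff)
  obtain N where N: "\<And>n. N \<le> n \<Longrightarrow> R_map \<phi> \<epsilon> ?\<BB> n None = None \<and> superlinear_at_infinity (R_map \<phi> \<epsilon> ?\<BB> n) \<and>
     union_inside ?\<BB> \<subseteq> filled_julia (R_map \<phi> \<epsilon> ?\<BB> n) \<and> common_outside ?\<BB> \<subseteq> basin (R_map \<phi> \<epsilon> ?\<BB> n)"
    using R_map_dynamics[OF choices finite_imageI[OF fin] subB translation_mutually_exterior[OF ext sub] zero] by blast
  show ?thesis
    unfolding Let_def inv_translation
  proof (intro exI[of _ N] allI impI)
    fix n assume n: "N \<le> n"
    let ?R = "R_map \<phi> \<epsilon> ?\<BB> n"
    let ?f = "translation (- t) \<circ> ?R \<circ> translation t"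
    note NR = N[OF n]
    have attr: "attracting_fixed_point_at_infinity ?f"
      using NR by (intro superlinear_imp_attracting superlinear_conjugate) auto
    have Ksub: "union_inside \<AA> \<subseteq> filled_julia ?f"
    proof
      fix p assume "p \<in> union_inside \<AA>"
      then have "translation t p \<in> union_inside ?\<BB>" unfolding translation_union_inside[OF sub] by blast
      then have "translation t p \<notin> basin ?R" using NR by (auto simp: filled_julia_def)
      then show "p \<in> filled_julia ?f" by (simp add: filled_julia_def basin_conjugate)
    qed
    have Lsub: "common_outside \<AA> \<subseteq> basin ?f"
      using NR translation_common_outside[OF sub] unfolding subset_iff basin_conjugate by blast
    show "attracting_fixed_point_at_infinity ?f \<and> union_inside \<AA> \<subseteq> filled_julia ?f \<and>
       common_outside \<AA> \<subseteq> basin ?f \<and> julia ?f \<subseteq> \<Union>\<AA> \<and>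
       (\<forall>A\<in>\<AA>. \<forall>p. pathin riemann_sphere p \<and> p 0 \<in> outside_of A \<and> p 1 \<in> inside_of A
          \<longrightarrow> p ` {0..1} \<inter> julia ?f \<noteq> {})"
      using attr Ksub Lsub julia_subset_union[OF fin sub Ksub Lsub] path_meets_julia[OF fin sub ext Ksub Lsub]
      by blast
  qed
qed

end
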